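(* Let $\alpha\in(0,1)$ and $1<p\leq q<\infty$ with $\frac1q+\frac1{p'}=\alpha$. Let $\Phi:[1,\infty)\to(0,\infty)$ be a monotone function such that for every sparse collection $\mathcal S$ of dyadic cubes there is a constant $C_{\mathcal S}<\infty$ with $$\|A^{2,\alpha}_{\mathcal S}\|_{L^p_{\omega^p}\to L^q_{\omega^q}}\leq C_{\mathcal S}\,\Phi([\omega]_{A_{pq}})\qquad\text{for all }\omega\in A_{pq}.$$ Then there is a constant $c>0$ such that $$\Phi(t)\geq c\,t^{\max\left(\frac{p'}{q}\alpha,\ \alpha-\frac12\right)}\qquad\text{for all }t\in[1,\infty).$$
   Context: Everything takes place in $\mathbb R^n$. A weight is a locally integrable function $\omega:\mathbb R^n\to[0,\infty)$, $\|f\|_{L^p_v}=(\int|f|^pv)^{1/p}$, $p'=p/(p-1)$. One-weight characteristic: for a weight $\omega$ (positive almost everywhere), $$[\omega]_{A_{pq}}:=\sup_Q\Big(\frac1{|Q|}\int_Q\omega^q\Big)\Big(\frac1{|Q|}\int_Q\omega^{-p'}\Big)^{q/p'},$$ the supremum being over all cubes $Q$ with sides parallel to the axes; $\omega\in A_{pq}$ means $[\omega]_{A_{pq}}<\infty$. Dyadic cubes are members of a dyadic grid, e.g. the standard grid $\{2^{-j}([0,1)^n+m): j\in\mathbb Z,m\in\mathbb Z^n\}$; the cubes of a given collection all belong to the same grid. A collection $\mathcal S$ of dyadic cubes is sparse if for some $\eta>0$ there are pairwise disjoint measurable sets $(E_Q)_{Q\in\mathcal S}$ with $E_Q\subset Q$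 and $|E_Q|\geq\eta|Q|$ for all $Q\in\mathcal S$. For measurable $f\geq0$, $$A^{2,\alpha}_{\mathcal S}(f)=\Big(\sum_{Q\in\mathcal S}\Big(|Q|^{-\alpha}\int_Qf\Big)^2\mathbf 1_Q\Big)^{1/2},$$ and $\|A^{2,\alpha}_{\mathcal S}\|_{L^p_{\omega^p}\to L^q_{\omega^q}}$ is the supremum of $\|A^{2,\alpha}_{\mathcal S}(f)\|_{L^q_{\omega^q}}$ over measurable $f\geq0$ with $\|f\|_{L^p_{\omega^p}}\leq1$. *)

theory Defs
  imports "HOL-Analysis.Analysis"
begin

text \<open>
  Norms, weight characteristics and operator norms may be infinite, so they take values in
  \<^typ>\<open>ennreal\<close>; the measure is Lebesgue measure throughout.
\<close>

text \<open>Powers on \<open>[0,\<infinity>]\<close>; only meant for exponents \<open>r > 0\<close>.\<close>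

definition epowr :: "ennreal \<Rightarrow> real \<Rightarrow> ennreal" (infixr "epowr" 80) where
  "x epowr r = (if x = \<infinity> then \<infinity> else ennreal (enn2real x powr r))"

definition dual_exp :: "real \<Rightarrow> real" where
  "dual_exp p = p / (p - 1)"

text \<open>The value of a characteristic or of an average does not depend on which faces belong to the
  cubes, so one half-open notion serves both for general axis-parallel cubes and for dyadic ones.\<close>

definition cube :: "real ^ 'n \<Rightarrow> real \<Rightarrow> (real ^ 'n) set" where
  "cube a l = {x. \<forall>i. a $ i \<le> x $ i \<and> x $ i < a $ i + l}"

definition weight :: "(real ^ 'n \<Rightarrow> real) \<Rightarrow> bool" where
  "weight w \<longleftrightarrow> (\<forall>x. 0 \<le> w x) \<and> (\<forall>K. compact K \<longrightarrow> w absolutely_integrable_on K)"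

definition average :: "(real ^ 'n) set \<Rightarrow> (real ^ 'n \<Rightarrow> real) \<Rightarrow> ennreal" where
  "average Q g = (\<integral>\<^sup>+x\<in>Q. ennreal (g x) \<partial>lebesgue) / emeasure lebesgue Q"

text \<open>On reals \<open>0 powr (- p') = 0\<close> instead of \<open>\<infinity>\<close>. This is harmless, because the characteristic is
  only used for weights that are positive almost everywhere.\<close>

definition Apq_char :: "real \<Rightarrow> real \<Rightarrow> (real ^ 'n \<Rightarrow> real) \<Rightarrow> ennreal" where
  "Apq_char p q w =
     (SUP (a, l) \<in> UNIV \<times> {0<..}.
        average (cube a l) (\<lambda>x. w x powr q) *
        average (cube a l) (\<lambda>x. w x powr (- dual_exp p)) epowr (q / dual_exp p))"

definition Apq :: "real \<Rightarrow> real \<Rightarrow> (real ^ 'n \<Rightarrow> real) set" where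
  "Apq p q = {w. weight w \<and> (AE x in lebesgue. 0 < w x) \<and> Apq_char p q w < \<infinity>}"

text \<open>A dyadic grid: cubes of side lengths \<open>2\<^sup>k\<close>, \<open>k\<close> an integer, those of each fixed side length
  tile the space, and any two cubes are nested or disjoint.\<close>

definition dyadic_grid :: "(real ^ 'n) set set \<Rightarrow> bool" where
  "dyadic_grid D \<longleftrightarrow>
     (\<forall>Q\<in>D. \<exists>a k. Q = cube a (2 powi k)) \<and>
     (\<forall>k. partition_on UNIV {Q \<in> D. \<exists>a. Q = cube a (2 powi k)}) \<and>
     (\<forall>Q\<in>D. \<forall>R\<in>D. Q \<inter> R \<in> {Q, R, {}})"

definition sparse_collection :: "(real ^ 'n) set set \<Rightarrow> bool" where
  "sparse_collection S \<longleftrightarrow>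
     (\<exists>\<eta>::real>0. \<exists>E. disjoint_family_on E S \<and>
        (\<forall>Q\<in>S. E Q \<in> sets lebesgue \<and> E Q \<subseteq> Q \<and>
                ennreal \<eta> * emeasure lebesgue Q \<le> emeasure lebesgue (E Q)))"

text \<open>The sum is the unconditional one, and every family is summable in \<^typ>\<open>ennreal\<close>.\<close>

definition sparse_op ::
    "real \<Rightarrow> (real ^ 'n) set set \<Rightarrow> (real ^ 'n \<Rightarrow> ennreal) \<Rightarrow> real ^ 'n \<Rightarrow> ennreal" where
  "sparse_op \<alpha> S f x =
     (\<Sum>\<^sub>\<infinity>Q\<in>S. (ennreal (measure lebesgue Q powr (- \<alpha>)) * (\<integral>\<^sup>+y\<in>Q. f y \<partial>lebesgue))\<^sup>2
                * indicator Q x) epowr (1 / 2)"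

definition wnorm :: "real \<Rightarrow> (real ^ 'n \<Rightarrow> real) \<Rightarrow> (real ^ 'n \<Rightarrow> ennreal) \<Rightarrow> ennreal" where
  "wnorm p v f = (\<integral>\<^sup>+x. f x epowr p * ennreal (v x) \<partial>lebesgue) epowr (1 / p)"

definition sparse_op_norm ::
    "real \<Rightarrow> (real ^ 'n) set set \<Rightarrow> real \<Rightarrow> real \<Rightarrow> (real ^ 'n \<Rightarrow> real) \<Rightarrow> ennreal" where
  "sparse_op_norm \<alpha> S p q w =
     (SUP f \<in> {f \<in> borel_measurable lebesgue. wnorm p (\<lambda>x. w x powr p) f \<le> 1}.
        wnorm q (\<lambda>x. w x powr q) (sparse_op \<alpha> S f))"

end

theory Submission
  imports Defs
begin

text \<open>
  One sparse collection suffices: the cubes \<open>Q\<^sub>k = [0, 2\<^sup>-\<^sup>k)\<^sup>N\<close>. Let \<open>h\<close> be the sup norm truncated to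
  \<open>[2\<^sup>-\<^sup>K, 1]\<close>. The average of \<open>h\<^sup>-\<^sup>N\<close> over a cube exceeds the value that scaling suggests by a factor
  of at most a multiple of \<open>K\<close>, the number of dyadic scales that carry equal mass.

  For \<open>w = h\<close> to the power \<open>N / p'\<close> the dual weight is \<open>h\<^sup>-\<^sup>N\<close>, so the characteristic is at most of order
  \<open>K\<close> to the power \<open>q / p'\<close>; testing on \<open>h\<^sup>-\<^sup>N\<close> and keeping only the smallest cube containing each point
  bounds the operator norm below by \<open>K\<close> to the power \<open>\<alpha>\<close>. For \<open>w = h\<close> to the power \<open>- N / q\<close> the
  characteristic is of order at most \<open>K\<close>; on \<open>h\<close> to the power \<open>- N (1 - \<alpha>)\<close> all terms of the square
  function are comparable, which yields \<open>K\<close> to the power \<open>\<alpha> - 1/2\<close>. Only upper bounds for the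
  characteristics are needed: a nondecreasing \<open>\<Phi>\<close> inherits the growth, and the first family rules out a
  nonincreasing one.
\<close>

section \<open>Powers on the extended half-line and the volume of cubes\<close>

lemma epowr_ennreal: "0 \<le> x \<Longrightarrow> ennreal x epowr r = ennreal (x powr r)"
  by (simp add: epowr_def)

lemma epowr_mono:
  assumes "x \<le> y" "0 \<le> r"
  shows "x epowr r \<le> y epowr r"
proof (cases "y = \<infinity>")
  case False
  then have "x \<noteq> \<infinity>" using assms(1) by (auto simp: top_unique)
  with False assms show ?thesis
    by (auto simp: epowr_def less_top intro!: ennreal_leI powr_mono2 enn2real_mono)
qed (simp add: epowr_def)

lemma cube_sets_borel: "cube a l \<in> sets borel"
proof -
  have "cube a l = {x\<in>space borel. \<forall>i. a $ i \<le> x $ i \<and> x $ i < a $ i + l}" by (simp add: cube_def)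
  also have "\<dots> \<in> sets borel" by measurable
  finally show ?thesis .
qed

lemma cube_sets_lebesgue [measurable]: "cube a l \<in> sets lebesgue"
  using cube_sets_borel by (metis sets_completionI_sets sets_lborel)

lemma emeasure_box_vec:
  fixes a :: "real ^ 'n"
  assumes "0 \<le> l"
  shows "emeasure lborel (box a (a + vec l)) = ennreal (l ^ CARD('n))"
    and "emeasure lborel (cbox a (a + vec l)) = ennreal (l ^ CARD('n))"
proof -
  have "(a + vec l - a) \<bullet> b = l" "a \<bullet> b \<le> (a + vec l) \<bullet> b" if "b \<in> Basis" for b
    using that assms by (auto simp: Basis_vec_def inner_axis algebra_simps)
  then show "emeasure lborel (box a (a + vec l)) = ennreal (l ^ CARD('n))"
    "emeasure lborel (cbox a (a + vec l)) = ennreal (l ^ CARD('n))"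
    by (simp_all add: emeasure_lborel_box_eq emeasure_lborel_cbox_eq)
qed

text \<open>The half-open cube lies between the open and the closed box with the same corners, and
  these have equal measure.\<close>

lemma emeasure_cube:
  fixes a :: "real ^ 'n"
  assumes "0 \<le> l"
  shows "emeasure lebesgue (cube a l) = ennreal (l ^ CARD('n))"
proof -
  have "box a (a + vec l) \<subseteq> cube a l" "cube a l \<subseteq> cbox a (a + vec l)"
    by (auto simp: cube_def mem_box_cart less_imp_le)
  then have "emeasure lborel (cube a l) = ennreal (l ^ CARD('n))"
    by (intro antisym)
      (metis emeasure_box_vec[OF assms, of a] emeasure_mono cube_sets_borel sets_lborel
         borel_closed closed_cbox)+
  then show ?thesis using cube_sets_borel[of a l] by (simp add: main_part_sets)
qed

lemma measure_cube:
  fixes a :: "real ^ 'n"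
  assumes "0 \<le> l"
  shows "measure lebesgue (cube a l) = l ^ CARD('n)"
  using emeasure_cube[OF assms, of a] assms by (simp add: measure_def del: emeasure_completion)

text \<open>Compare volumes. Applied in both directions, this shows that a cube, as a set,
  determines its side length.\<close>

lemma cube_subset_imp_le:
  fixes a b :: "real ^ 'n"
  assumes "cube a k \<subseteq> cube b l" "0 < k" "0 < l"
  shows "k \<le> l"
proof -
  have "emeasure lebesgue (cube a k) \<le> emeasure lebesgue (cube b l)"
    using assms by (intro emeasure_mono) auto
  then have "k ^ CARD('n) \<le> l ^ CARD('n)" using assms by (simp add: emeasure_cube del: emeasure_completion)
  then show ?thesis using assms by (meson power_mono_iff less_imp_le zero_less_card_finite)
qed

section \<open>The standard dyadic grid\<close>

definition standard_grid :: "(real ^ 'n) set set" where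
  "standard_grid = {cube (\<chi> i. of_int (m i) * 2 powi k) (2 powi k) |m k. True}"

text \<open>In terms of floors, disjointness, covering and nesting of dyadic cubes become integer
  arithmetic.\<close>

lemma mem_dyadic_cube:
  "x \<in> cube (\<chi> i. of_int (m i) * 2 powi k) (2 powi k) \<longleftrightarrow> (\<forall>i. \<lfloor>x $ i / 2 powi k\<rfloor> = m i)"
proof -
  have "(of_int (m i) * 2 powi k \<le> x $ i \<and> x $ i < of_int (m i) * 2 powi k + 2 powi k)
      \<longleftrightarrow> \<lfloor>x $ i / 2 powi k\<rfloor> = m i" for i
  proof -
    have "(0::real) < 2 powi k" by simp
    then show ?thesis by (simp add: floor_eq_iff field_simps)
  qed
  then show ?thesis by (simp add: cube_def)
qed

lemma dyadic_cubes_nested: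
  assumes "k \<le> l" and x: "x \<in> cube (\<chi> i. of_int (m i) * 2 powi k) (2 powi k)"
    "x \<in> cube (\<chi> i. of_int (m' i) * 2 powi l) (2 powi l)"
  shows "cube (\<chi> i. of_int (m i) * 2 powi k) (2 powi k) \<subseteq> cube (\<chi> i. of_int (m' i) * 2 powi l) (2 powi l)"
proof
  fix y :: "real ^ 'a"
  assume y: "y \<in> cube (\<chi> i. of_int (m i) * 2 powi k) (2 powi k)"
  \<comment> \<open>The index at the coarse scale is an integer quotient of the index at the fine
    scale, so points with equal fine indices have equal coarse ones.\<close>
  have fl: "\<lfloor>t / 2 powi l\<rfloor> = \<lfloor>t / 2 powi k\<rfloor> div 2 ^ nat (l - k)" for t :: real
  proof -
    have "(2::real) powi l = 2 powi k * of_int (2 ^ nat (l - k))"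
      using assms(1) by (simp add: power_int_add[symmetric] flip: power_int_of_nat)
    then have "t / 2 powi l = (t / 2 powi k) / of_int (2 ^ nat (l - k))" by simp
    then show ?thesis by (metis floor_divide_real_eq_div zero_le_numeral zero_le_power)
  qed
  show "y \<in> cube (\<chi> i. of_int (m' i) * 2 powi l) (2 powi l)"
    using x y unfolding mem_dyadic_cube by (metis fl)
qed

lemma dyadic_grid_standard: "dyadic_grid (standard_grid :: (real ^ 'n) set set)"
  unfolding dyadic_grid_def
proof (intro conjI ballI allI)
  fix Q :: "(real ^ 'n) set" assume "Q \<in> standard_grid"
  then show "\<exists>a k. Q = cube a (2 powi k)" unfolding standard_grid_def by blast
next
  fix k :: int
  let ?P = "{Q \<in> standard_grid. \<exists>a::real ^ 'n. Q = cube a (2 powi k)}"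
  \<comment> \<open>A grid cube of side \<open>2 powi k\<close> may have been presented with another
    exponent \<open>k'\<close>; the two side lengths agree because the set determines them.\<close>
  have P: "?P = range (\<lambda>m. cube (\<chi> i. of_int (m i) * 2 powi k) (2 powi k))"
  proof (intro set_eqI iffI)
    fix Q assume "Q \<in> ?P"
    then obtain m k' a where Q: "Q = cube (\<chi> i. of_int (m i) * 2 powi k') (2 powi k')"
      "Q = cube a (2 powi k)" unfolding standard_grid_def by blast
    then have "(2::real) powi k = 2 powi k'"
      by (metis cube_subset_imp_le antisym order_refl zero_less_numeral zero_less_power_int)
    then show "Q \<in> range (\<lambda>m. cube (\<chi> i. of_int (m i) * 2 powi k) (2 powi k))"
      using Q by auto
  qed (auto simp: standard_grid_def)
  show "partition_on UNIV ?P"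
    unfolding P
  proof (rule partition_onI)
    fix Q R :: "(real ^ 'n) set"
    assume "Q \<in> range (\<lambda>m. cube (\<chi> i. of_int (m i) * 2 powi k) (2 powi k))"
      "R \<in> range (\<lambda>m. cube (\<chi> i. of_int (m i) * 2 powi k) (2 powi k))" "Q \<noteq> R"
    then show "disjnt Q R"
      by (auto simp: disjnt_def mem_dyadic_cube)
  next
    show "{} \<notin> range (\<lambda>m. cube (\<chi> i. of_int (m i) * 2 powi k) (2 powi k) :: (real ^ 'n) set)"
    proof
      assume "{} \<in> range (\<lambda>m. cube (\<chi> i. of_int (m i) * 2 powi k) (2 powi k) :: (real ^ 'n) set)"
      then obtain m where m: "{} = (cube (\<chi> i. of_int (m i) * 2 powi k) (2 powi k) :: (real ^ 'n) set)" by blast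
      have "(\<chi> i. of_int (m i) * 2 powi k) \<in> (cube (\<chi> i. of_int (m i) * 2 powi k) (2 powi k) :: (real ^ 'n) set)"
        by (simp add: cube_def)
      then show False using m by blast
    qed
  next
    show "\<Union> (range (\<lambda>m. cube (\<chi> i. of_int (m i) * 2 powi k) (2 powi k))) = (UNIV :: (real ^ 'n) set)"
    proof (intro set_eqI iffI UNIV_I)
      fix x :: "real ^ 'n"
      have "x \<in> cube (\<chi> i. of_int ((\<lambda>i. \<lfloor>x $ i / 2 powi k\<rfloor>) i) * 2 powi k) (2 powi k)"
        unfolding mem_dyadic_cube by simp
      then show "x \<in> \<Union> (range (\<lambda>m. cube (\<chi> i. of_int (m i) * 2 powi k) (2 powi k)))"
        by (rule UnionI[rotated]) (rule rangeI)
    qed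
  qed
next
  fix Q R :: "(real ^ 'n) set"
  assume "Q \<in> standard_grid" "R \<in> standard_grid"
  then obtain m k m' k' where *: "Q = cube (\<chi> i. of_int (m i) * 2 powi k) (2 powi k)"
    "R = cube (\<chi> i. of_int (m' i) * 2 powi k') (2 powi k')" unfolding standard_grid_def by blast
  have "Q \<subseteq> R \<or> R \<subseteq> Q" if "Q \<inter> R \<noteq> {}"
  proof -
    from that obtain x where x: "x \<in> Q" "x \<in> R" by blast
    show ?thesis
    proof (cases "k \<le> k'")
      case True
      then show ?thesis using dyadic_cubes_nested[OF True] x unfolding * by metis
    next
      case False
      then have "k' \<le> k" by simp
      then show ?thesis using dyadic_cubes_nested[of k' k] x unfolding * by metis
    qed
  qed
  then show "Q \<inter> R \<in> {Q, R, {}}" by auto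
qed

section \<open>Shrinking cubes at the origin and the truncated radius\<close>

definition dcube :: "nat \<Rightarrow> (real ^ 'n) set" where
  "dcube k = cube 0 ((1 / 2) ^ k)"

text \<open>The shells serve both as the disjoint sets that witness sparsity and as the regions on
  which integrals are bounded from below.\<close>

definition shell :: "nat \<Rightarrow> (real ^ 'n) set" where
  "shell k = dcube k - dcube (Suc k)"

lemma mem_dcube: "x \<in> dcube k \<longleftrightarrow> (\<forall>i. 0 \<le> x $ i \<and> x $ i < (1 / 2) ^ k)"
  by (simp add: dcube_def cube_def)

lemma dcube_antimono: "k \<le> l \<Longrightarrow> dcube l \<subseteq> dcube k"
  unfolding subset_iff mem_dcube
  by (meson less_le_trans power_decreasing half_gt_zero less_imp_le zero_less_one zero_le_divide_1_iff zero_le_numeral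
      divide_le_eq_1 one_le_numeral)

lemma dcube_sets [measurable]: "dcube k \<in> sets lebesgue"
  by (simp add: dcube_def cube_sets_lebesgue)

lemma shell_sets [measurable]: "shell k \<in> sets lebesgue"
  by (simp add: shell_def)

lemma emeasure_dcube: "emeasure lebesgue (dcube k :: (real ^ 'n) set) = ennreal (((1 / 2) ^ k) ^ CARD('n))"
  and measure_dcube: "measure lebesgue (dcube k :: (real ^ 'n) set) = ((1 / 2) ^ k) ^ CARD('n)"
  unfolding dcube_def by (rule emeasure_cube measure_cube; simp)+

text \<open>The removed cube has \<open>(1 / 2) ^ CARD('n)\<close> times the volume of
  \<open>dcube k\<close>, which is at most half because the dimension is at least 1.\<close>

lemma emeasure_shell_ge:
  "emeasure lebesgue (shell k :: (real ^ 'n) set) \<ge> ennreal (((1 / 2) ^ k) ^ CARD('n) / 2)"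
proof -
  let ?v = "((1 / 2) ^ k) ^ CARD('n) :: real"
  have "emeasure lebesgue (shell k :: (real ^ 'n) set)
      = emeasure lebesgue (dcube k :: (real ^ 'n) set) - emeasure lebesgue (dcube (Suc k) :: (real ^ 'n) set)"
    unfolding shell_def
    by (rule emeasure_Diff) (simp_all add: emeasure_dcube dcube_antimono del: emeasure_completion)
  also have "\<dots> = ennreal (?v - ((1 / 2) ^ Suc k) ^ CARD('n))"
    by (simp add: emeasure_dcube ennreal_minus del: emeasure_completion power_Suc)
  also have "\<dots> \<ge> ennreal (?v / 2)"
  proof (rule ennreal_leI)
    have "((1 / 2) ^ Suc k) ^ CARD('n) = ?v * (1 / 2) ^ CARD('n)"
      by (simp add: power_mult_distrib[symmetric])
    also have "\<dots> \<le> ?v * (1 / 2) ^ 1"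
      by (intro mult_left_mono power_decreasing) (auto simp: Suc_le_eq)
    finally show "?v / 2 \<le> ?v - ((1 / 2) ^ Suc k) ^ CARD('n)" by simp
  qed
  finally show ?thesis .
qed

lemma inj_dcube: "inj (dcube :: nat \<Rightarrow> (real ^ 'n) set)"
proof (rule injI)
  fix k l :: nat
  assume "dcube k = (dcube l :: (real ^ 'n) set)"
  then have "((1 / 2) ^ k :: real) = (1 / 2) ^ l"
    unfolding dcube_def by (metis cube_subset_imp_le antisym order_refl zero_less_power half_gt_zero zero_less_one)
  then show "k = l" by (simp add: power_inject_exp')
qed

lemma dcube_in_standard_grid: "dcube k \<in> (standard_grid :: (real ^ 'n) set set)"
proof -
  have "dcube k = cube (\<chi> i. of_int ((\<lambda>_. 0) i) * 2 powi (- int k)) (2 powi (- int k) :: real)"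
    by (simp add: dcube_def power_int_minus power_one_over zero_vec_def inverse_eq_divide)
  then show ?thesis unfolding standard_grid_def by (intro CollectI exI[of _ "\<lambda>_. 0"] exI[of _ "- int k"]) simp
qed

lemma shell_disjoint: "k < l \<Longrightarrow> shell k \<inter> shell l = {}"
  using dcube_antimono[of "Suc k" l] unfolding shell_def by auto

lemma disjoint_family_shell: "disjoint_family shell"
  unfolding disjoint_family_on_def
  by (metis shell_disjoint Int_commute linorder_neqE_nat)

text \<open>The witnesses must depend on the cube and not on its index; since \<open>dcube\<close>
  is injective, \<open>the_inv\<close> recovers the index.\<close>

lemma sparse_collection_dcube: "sparse_collection (range dcube :: (real ^ 'n) set set)"
  unfolding sparse_collection_def
proof (intro exI[of _ "1 / 2 :: real"] exI[of _ "\<lambda>Q. shell (the_inv dcube Q)"] conjI ballI)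
  show "disjoint_family_on (\<lambda>Q. shell (the_inv dcube Q)) (range dcube :: (real ^ 'n) set set)"
    using disjoint_family_shell
    unfolding disjoint_family_on_def by (metis the_inv_f_f[OF inj_dcube] imageE)
next
  fix Q :: "(real ^ 'n) set" assume "Q \<in> range dcube"
  then obtain k where Q: "Q = dcube k" by blast
  show "(shell (the_inv dcube Q) :: (real ^ 'n) set) \<in> sets lebesgue" by simp
  show "shell (the_inv dcube Q) \<subseteq> Q"
    by (simp add: Q the_inv_f_f[OF inj_dcube] shell_def)
  have "ennreal (1 / 2) * ennreal (((1 / 2) ^ k) ^ CARD('n)) = ennreal (((1 / 2) ^ k) ^ CARD('n) / 2)"
    by (subst ennreal_mult[symmetric]) auto
  then show "ennreal (1 / 2) * emeasure lebesgue Q \<le> emeasure lebesgue (shell (the_inv dcube Q) :: (real ^ 'n) set)"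
    unfolding Q the_inv_f_f[OF inj_dcube] emeasure_dcube using emeasure_shell_ge[of k, where 'n = 'n] by metis
qed simp

section \<open>The sup norm truncated to finitely many dyadic scales\<close>

definition clamp :: "nat \<Rightarrow> real \<Rightarrow> real" where
  "clamp K t = max ((1 / 2) ^ K) (min 1 t)"

lemma clamp_pos [simp]: "0 < clamp K t"
  by (simp add: clamp_def less_max_iff_disj)

lemma clamp_nonneg [simp]: "0 \<le> clamp K t"
  by (simp add: less_imp_le)

lemma clamp_mono: "s \<le> t \<Longrightarrow> clamp K s \<le> clamp K t"
  by (auto simp: clamp_def)

lemma clamp_le_1: "clamp K t \<le> 1"
  by (simp add: clamp_def power_le_one)

text \<open>A doubling property: it makes the radius nearly constant on cubes that are small
  compared with their distance from the origin.\<close>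

lemma clamp_half: "clamp K t \<le> 2 * clamp K (t / 2)"
proof -
  have "(0::real) < (1 / 2) ^ K" by simp
  then show ?thesis unfolding clamp_def max_def min_def by (smt (verit) field_sum_of_halves)
qed

lemma clamp_eq_1: "1 \<le> t \<Longrightarrow> clamp K t = 1"
  by (simp add: clamp_def power_le_one)

definition radius :: "nat \<Rightarrow> real ^ 'n \<Rightarrow> real" where
  "radius K x = clamp K (infnorm x)"

lemma radius_pos [simp]: "0 < radius K x"
  by (simp add: radius_def)

lemma radius_nonneg [simp]: "0 \<le> radius K x"
  by (simp add: radius_def)

lemma continuous_on_radius: "continuous_on A (radius K)"
  unfolding radius_def clamp_def by (intro continuous_intros)

lemma continuous_on_radius_powr: "continuous_on A (\<lambda>x. radius K x powr s)"
  by (intro continuous_on_powr continuous_on_radius continuous_on_const)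
     (simp add: less_imp_neq[OF radius_pos, symmetric])

lemma radius_powr_measurable [measurable]:
  "(\<lambda>x::real ^ 'n. radius K x powr s) \<in> borel_measurable lebesgue"
  using borel_measurable_continuous_onI[OF continuous_on_radius_powr[of UNIV K s]]
  by (intro measurable_completion) simp

lemma infnorm_le_vec:
  fixes x :: "real ^ 'n"
  assumes "\<And>i. \<bar>x $ i\<bar> \<le> b"
  shows "infnorm x \<le> b"
  unfolding infnorm_cart using assms by (auto intro!: cSup_least)

lemma infnorm_le_on_cube:
  fixes x :: "real ^ 'n"
  assumes "x \<in> cube a l"
  shows "\<bar>infnorm x - infnorm a\<bar> \<le> l"
proof -
  have "infnorm (x - a) \<le> l"
    using assms by (intro infnorm_le_vec) (auto simp: cube_def abs_le_iff, smt (verit))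
  then show ?thesis using absdiff_infnorm[of x a] by linarith
qed

text \<open>Beyond scale \<open>K\<close> the cutoff \<open>(1 / 2) ^ K\<close> would exceed the
  bound, hence \<open>k \<le> K\<close>.\<close>

lemma radius_dcube_le:
  assumes "x \<in> dcube k" "k \<le> K"
  shows "radius K x \<le> (1 / 2) ^ k"
proof -
  have "infnorm x \<le> (1 / 2) ^ k"
    using assms(1) by (intro infnorm_le_vec) (auto simp: mem_dcube abs_le_iff less_imp_le intro: order_trans[of _ 0])
  moreover have "(1 / 2 :: real) ^ K \<le> (1 / 2) ^ k" by (rule power_decreasing[OF assms(2)]) auto
  ultimately show ?thesis by (auto simp: radius_def clamp_def)
qed

lemma radius_shell_ge:
  assumes "x \<in> shell k"
  shows "(1 / 2) ^ Suc k \<le> radius K x"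
proof -
  obtain i where "(1 / 2) ^ Suc k \<le> x $ i"
    using assms unfolding shell_def Diff_iff mem_dcube by (meson not_less)
  also have "x $ i \<le> infnorm x" using component_le_infnorm_cart[of x i] by simp
  finally have "(1 / 2) ^ Suc k \<le> infnorm x" .
  moreover have "(1 / 2 :: real) ^ Suc k \<le> 1" by (rule power_le_one) auto
  ultimately show ?thesis by (simp add: radius_def clamp_def le_max_iff_disj del: power_Suc)
qed

text \<open>A layer decomposition: the term of the finest scale \<open>j \<le> K\<close> with
  \<open>t < (1 / 2) ^ j\<close> already dominates, and the summand 1 covers
  \<open>1 \<le> t\<close>.\<close>

lemma clamp_powr_le_sum:
  assumes "0 \<le> t"
  shows "inverse (clamp K t) ^ N \<le> 1 + (\<Sum>j\<le>K. (2 ^ Suc j) ^ N * indicator {t. t < (1 / 2) ^ j} t)"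
proof (cases "t < 1")
  case False
  then show ?thesis by (simp add: clamp_eq_1 sum_nonneg)
next
  case True
  define j where "j = (GREATEST j. j \<le> K \<and> t < (1 / 2) ^ j)"
  have j: "j \<le> K \<and> t < (1 / 2) ^ j"
    unfolding j_def by (rule GreatestI_nat[where b = K]) (use True in auto)
  have "inverse (clamp K t) \<le> 2 ^ Suc j"
  \<comment> \<open>At the last scale the cutoff bounds the inverse; at any earlier one the
    maximality of \<open>j\<close> gives \<open>(1 / 2) ^ Suc j \<le> t\<close>.\<close>
  proof (cases "j = K")
    case True
    have "inverse (clamp K t) \<le> inverse ((1 / 2) ^ K)"
      by (rule le_imp_inverse_le) (auto simp: clamp_def)
    also have "\<dots> \<le> 2 ^ Suc j" by (simp add: True power_one_over)
    finally show ?thesis .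
  next
    case False
    have "\<not> t < (1 / 2) ^ Suc j"
    proof
      assume "t < (1 / 2) ^ Suc j"
      then have "Suc j \<le> j" unfolding j_def
        by (intro Greatest_le_nat[where b = K]) (use False j j_def in auto)
      then show False by simp
    qed
    then have "(1 / 2) ^ Suc j \<le> clamp K t"
      using \<open>t < 1\<close> by (auto simp: clamp_def)
    then have "inverse (clamp K t) \<le> inverse ((1 / 2) ^ Suc j)"
      by (rule le_imp_inverse_le) simp
    then show ?thesis by (simp add: power_one_over)
  qed
  then have "inverse (clamp K t) ^ N \<le> (2 ^ Suc j) ^ N * indicator {t. t < (1 / 2) ^ j} t"
    using j by (simp add: power_mono del: power_Suc)
  also have "\<dots> \<le> (\<Sum>j\<le>K. (2 ^ Suc j) ^ N * indicator {t. t < (1 / 2) ^ j} t)"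
    using j by (intro member_le_sum) auto
  finally show ?thesis by simp
qed

section \<open>Characteristics of radial weights\<close>

text \<open>A sup norm ball of radius \<open>r\<close> lies in a cube of side \<open>2 * r\<close>,
  so the smaller of two volumes is a bound.\<close>

lemma emeasure_cube_infnorm_le:
  fixes a :: "real ^ 'n"
  assumes "0 < l" "0 \<le> r"
  shows "emeasure lebesgue (cube a l \<inter> {x. infnorm x < r}) \<le> ennreal (min l (2 * r) ^ CARD('n))"
proof -
  have "cube a l \<inter> {x. infnorm x < r} \<subseteq> cube (- vec r) (2 * r)"
  proof
    fix x :: "real ^ 'n" assume "x \<in> cube a l \<inter> {x. infnorm x < r}"
    then have "\<bar>x $ i\<bar> < r" for i
      using component_le_infnorm_cart[of x i] by simp
    then show "x \<in> cube (- vec r) (2 * r)"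
      unfolding cube_def by (auto simp: abs_less_iff) (smt (verit))+
  qed
  then have "emeasure lebesgue (cube a l \<inter> {x. infnorm x < r}) \<le> emeasure lebesgue (cube (- vec r :: real ^ 'n) (2 * r))"
    by (intro emeasure_mono) auto
  moreover have "emeasure lebesgue (cube a l \<inter> {x. infnorm x < r}) \<le> emeasure lebesgue (cube a l)"
    by (intro emeasure_mono) auto
  ultimately show ?thesis using assms
    by (auto simp: emeasure_cube min_def simp del: emeasure_completion)
qed

lemma average_le:
  assumes "0 < l" "0 \<le> C" "(\<integral>\<^sup>+x\<in>cube a l. ennreal (g x) \<partial>lebesgue) \<le> ennreal (C * l ^ CARD('n))"
  shows "average (cube (a :: real ^ 'n) l) g \<le> ennreal C"
proof -
  have "average (cube a l) g \<le> ennreal (C * l ^ CARD('n)) / ennreal (l ^ CARD('n))"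
    unfolding average_def using assms
    by (simp add: emeasure_cube divide_right_mono_ennreal del: emeasure_completion)
  also have "\<dots> = ennreal C"
    using assms by (simp add: divide_ennreal)
  finally show ?thesis .
qed

lemma average_le_bound:
  assumes "0 < l" "0 \<le> C" "\<And>x. x \<in> cube a l \<Longrightarrow> g x \<le> C"
  shows "average (cube (a :: real ^ 'n) l) g \<le> ennreal C"
proof (rule average_le[OF assms(1,2)])
  have "(\<integral>\<^sup>+x\<in>cube a l. ennreal (g x) \<partial>lebesgue) \<le> (\<integral>\<^sup>+x\<in>cube a l. ennreal C \<partial>lebesgue)"
    using assms(3) by (intro nn_integral_mono) (auto simp: indicator_def intro: ennreal_leI)
  also have "\<dots> = ennreal (C * l ^ CARD('n))"
    using assms by (simp add: nn_integral_cmult emeasure_cube ennreal_mult del: emeasure_completion)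
  finally show "(\<integral>\<^sup>+x\<in>cube a l. ennreal (g x) \<partial>lebesgue) \<le> ennreal (C * l ^ CARD('n))" .
qed

lemma radius_powr_neg: "radius K x powr (- real N) = inverse (radius K x) ^ N"
  by (simp add: powr_minus powr_realpow power_inverse)

text \<open>This merges the two bounds for a layer, one from the cutoff and one from the size
  \<open>M\<close> of the cube, into a power of the truncated size.\<close>

lemma min_clamp_inverse:
  assumes "0 < M"
  shows "min (2 ^ K) (inverse M) \<le> inverse (clamp K M)"
proof (cases "M \<le> (1 / 2) ^ K")
  case True
  then have "clamp K M = (1 / 2) ^ K" using power_le_one[of "1 / 2 :: real" K] by (simp add: clamp_def)
  then show ?thesis by (simp add: power_one_over)
next
  case False
  then have "clamp K M \<le> M" by (simp add: clamp_def)
  then have "inverse M \<le> inverse (clamp K M)" by (intro le_imp_inverse_le) auto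
  then show ?thesis by simp
qed

text \<open>The main estimate for the critical power. The sup norm is at most
  \<open>infnorm a + l\<close> on the cube, and the average exceeds the value at that distance by a
  factor of order \<open>K\<close> at most. A cube far from the origin sees almost one value; a cube
  near it meets at most \<open>K + 1\<close> layers, each with a comparable contribution.\<close>

lemma average_singular_le:
  fixes a :: "real ^ 'n"
  assumes "0 < l" "1 \<le> K"
  shows "average (cube a l) (\<lambda>x. radius K x powr (- real CARD('n)))
    \<le> ennreal (3 * 16 ^ CARD('n) * real K * clamp K (infnorm a + l) powr (- real CARD('n)))"
proof -
  let ?N = "CARD('n)"
  define M where "M = infnorm a + l"
  define r where "r = clamp K M"
  have a0: "0 \<le> infnorm a" by (rule infnorm_pos_le)
  have M: "0 < M" using assms a0 by (simp add: M_def)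
  have r: "0 < r" "r \<le> 1" by (simp_all add: r_def clamp_le_1)
  have rN: "1 \<le> inverse r ^ ?N"
    using r by (intro one_le_power) (simp add: one_le_inverse)
  have rp: "r powr (- real ?N) = inverse r ^ ?N"
    using r by (simp add: powr_minus powr_realpow power_inverse)
  show ?thesis
  proof (cases "l \<le> M / 4")
    case True
    txt \<open>Far from the origin, relative to its size, the cube sees an almost constant radius.\<close>
    show ?thesis
      unfolding M_def[symmetric] r_def[symmetric] rp
    proof (rule average_le_bound[OF assms(1)])
      fix x assume x: "x \<in> cube a l"
      have "M / 2 \<le> infnorm x" using infnorm_le_on_cube[OF x] True by (simp add: M_def)
      then have "clamp K (M / 2) \<le> radius K x" unfolding radius_def by (rule clamp_mono)
      then have "r / 2 \<le> radius K x" using clamp_half[of K M] unfolding r_def by simp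
      then have "inverse (radius K x) \<le> inverse (r / 2)" using r by (intro le_imp_inverse_le) auto
      then have "radius K x powr (- real ?N) \<le> inverse (r / 2) ^ ?N"
        unfolding radius_powr_neg by (intro power_mono) auto
      also have "\<dots> = 2 ^ ?N * inverse r ^ ?N"
      proof -
        have "inverse (r / 2) = 2 * inverse r" by (simp add: field_simps)
        then show ?thesis by (simp only: power_mult_distrib)
      qed
      also have "\<dots> \<le> (3 * 16 ^ ?N * real K) * inverse r ^ ?N"
      proof (rule mult_right_mono)
        have "(2::real) ^ ?N \<le> 16 ^ ?N" by (rule power_mono) auto
        also have "\<dots> \<le> 3 * 16 ^ ?N * real K"
        proof -
          have "1 \<le> 3 * real K" using assms(2) by simp
          then have "16 ^ ?N * 1 \<le> 16 ^ ?N * (3 * real K)" by (rule mult_left_mono) simp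
          then show ?thesis by simp
        qed
        finally show "(2::real) ^ ?N \<le> 3 * 16 ^ ?N * real K" .
      qed (use r in simp)
      finally show "radius K x powr (- real ?N) \<le> 3 * 16 ^ ?N * real K * inverse r ^ ?N" .
    qed (use r in simp)
  next
    case False
    then have lM: "M < 4 * l" by simp
    \<comment> \<open>Now \<open>l\<close> and \<open>M\<close> are comparable, and the integral is
      split into the layers \<open>?B j\<close>. Each will contribute at most a fixed multiple of
      \<open>inverse r ^ ?N * l ^ ?N\<close>.\<close>
    let ?B = "\<lambda>j. cube a l \<inter> {x. infnorm x < (1 / 2) ^ j}"
    have B[measurable]: "?B j \<in> sets lebesgue" for j
    proof -
      have "open {x :: real ^ 'n. infnorm x < (1 / 2) ^ j}"
        by (intro open_Collect_less continuous_intros)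
      then have "{x :: real ^ 'n. infnorm x < (1 / 2) ^ j} \<in> sets lebesgue"
        by (intro sets_completionI_sets) simp
      then show ?thesis by simp
    qed
    have "(\<integral>\<^sup>+x\<in>cube a l. ennreal (radius K x powr (- real ?N)) \<partial>lebesgue)
      \<le> (\<integral>\<^sup>+x. indicator (cube a l) x + (\<Sum>j\<le>K. ennreal ((2 ^ Suc j) ^ ?N) * indicator (?B j) x) \<partial>lebesgue)"
    proof (rule nn_integral_mono)
      fix x :: "real ^ 'n"
      have *: "radius K x powr (- real ?N)
          \<le> 1 + (\<Sum>j\<le>K. (2 ^ Suc j) ^ ?N * indicator {t. t < (1 / 2) ^ j} (infnorm x))"
        unfolding radius_powr_neg unfolding radius_def
        by (rule clamp_powr_le_sum) (rule infnorm_pos_le)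
      have "ennreal (1 + (\<Sum>j\<le>K. (2 ^ Suc j) ^ ?N * indicator {t. t < (1 / 2) ^ j} (infnorm x)))
          = 1 + (\<Sum>j\<le>K. ennreal ((2 ^ Suc j) ^ ?N) * indicator {x. infnorm x < (1 / 2) ^ j} x)"
      proof -
        have "ennreal (\<Sum>j\<le>K. (2 ^ Suc j) ^ ?N * indicator {t. t < (1 / 2) ^ j} (infnorm x))
            = (\<Sum>j\<le>K. ennreal ((2 ^ Suc j) ^ ?N * indicator {t. t < (1 / 2) ^ j} (infnorm x)))"
          by (rule sum_ennreal[symmetric]) simp
        also have "\<dots> = (\<Sum>j\<le>K. ennreal ((2 ^ Suc j) ^ ?N) * indicator {x. infnorm x < (1 / 2) ^ j} x)"
          by (rule sum.cong) (auto simp: indicator_def simp del: power_Suc)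
        finally show ?thesis
          by (subst ennreal_plus) (auto intro!: sum_nonneg simp del: power_Suc)
      qed
      with ennreal_leI[OF *]
      show "ennreal (radius K x powr (- real ?N)) * indicator (cube a l) x
        \<le> indicator (cube a l) x + (\<Sum>j\<le>K. ennreal ((2 ^ Suc j) ^ ?N) * indicator (?B j) x)"
        by (auto simp: indicator_def simp del: power_Suc)
    qed
    also have "\<dots> = emeasure lebesgue (cube a l) + (\<Sum>j\<le>K. ennreal ((2 ^ Suc j) ^ ?N) * emeasure lebesgue (?B j))"
    proof -
      have "(\<integral>\<^sup>+x. indicator (cube a l) x + (\<Sum>j\<le>K. ennreal ((2 ^ Suc j) ^ ?N) * indicator (?B j) x) \<partial>lebesgue)
        = (\<integral>\<^sup>+x. indicator (cube a l) x \<partial>lebesgue)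
          + (\<integral>\<^sup>+x. (\<Sum>j\<le>K. ennreal ((2 ^ Suc j) ^ ?N) * indicator (?B j) x) \<partial>lebesgue)"
        using B by (intro nn_integral_add borel_measurable_sum borel_measurable_times_ennreal borel_measurable_indicator)
          auto
      also have "(\<integral>\<^sup>+x. (\<Sum>j\<le>K. ennreal ((2 ^ Suc j) ^ ?N) * indicator (?B j) x) \<partial>lebesgue)
        = (\<Sum>j\<le>K. \<integral>\<^sup>+x. ennreal ((2 ^ Suc j) ^ ?N) * indicator (?B j) x \<partial>lebesgue)"
        using B by (intro nn_integral_sum borel_measurable_times_ennreal borel_measurable_indicator) auto
      finally show ?thesis
        using B by (simp only: nn_integral_cmult_indicator nn_integral_indicator cube_sets_lebesgue)
    qed
    also have "\<dots> \<le> ennreal (l ^ ?N) + (\<Sum>j\<le>K. ennreal (16 ^ ?N * inverse r ^ ?N * l ^ ?N))"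
    proof (intro add_mono sum_mono)
      show "emeasure lebesgue (cube a l) \<le> ennreal (l ^ ?N)"
        using assms by (simp add: emeasure_cube del: emeasure_completion)
      fix j assume j: "j \<in> {..K}"
      have "emeasure lebesgue (?B j) \<le> ennreal (min l (2 * (1 / 2) ^ j) ^ ?N)"
        by (rule emeasure_cube_infnorm_le) (use assms in auto)
      then have "ennreal ((2 ^ Suc j) ^ ?N) * emeasure lebesgue (?B j)
          \<le> ennreal ((2 ^ Suc j) ^ ?N) * ennreal (min l (2 * (1 / 2) ^ j) ^ ?N)"
        by (rule mult_left_mono) simp
      also have "\<dots> = ennreal ((2 ^ Suc j * min l (2 * (1 / 2) ^ j)) ^ ?N)"
        using assms by (simp add: ennreal_mult[symmetric] power_mult_distrib[symmetric] del: power_Suc)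
      also have "\<dots> \<le> ennreal ((16 * inverse r * l) ^ ?N)"
      proof (intro ennreal_leI power_mono)
        have "2 ^ Suc j * min l (2 * (1 / 2) ^ j) = min (2 ^ Suc j * l) (2 ^ Suc j * (2 * (1 / 2) ^ j))"
          by (simp add: min_mult_distrib_left del: power_Suc)
        also have "\<dots> = min (2 * 2 ^ j * l) 4" by (simp add: power_one_over)
        \<comment> \<open>If \<open>M\<close> is below the cutoff, \<open>2 ^ j \<le> 2 ^ K\<close>
          bounds the first entry of the minimum. Otherwise the second entry 4 is used, since
          \<open>M < 4 * l\<close> gives \<open>4 \<le> 16 * l * inverse M\<close>.\<close>
        also have "\<dots> \<le> 16 * l * min (2 ^ K) (inverse M)"
        proof (cases "2 ^ K \<le> inverse M")
          case True
          have "(2::real) ^ j \<le> 2 ^ K" using j by (intro power_increasing) auto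
          moreover have "(0::real) \<le> 2 ^ K" by simp
          ultimately have "2 * 2 ^ j \<le> 16 * (2::real) ^ K" by linarith
          then have "2 * 2 ^ j * l \<le> 16 * 2 ^ K * l" by (rule mult_right_mono) (use assms in simp)
          then have "2 * 2 ^ j * l \<le> 16 * l * 2 ^ K" by (simp only: mult_ac)
          then show ?thesis using True by (simp add: min_def)
        next
          case False
          have "1 \<le> 4 * l * inverse M" using lM M by (simp add: field_simps)
          then show ?thesis using False by (simp add: min_def)
        qed
        also have "\<dots> \<le> 16 * l * inverse r"
          unfolding r_def by (intro mult_left_mono min_clamp_inverse) (use assms M in auto)
        finally show "2 ^ Suc j * min l (2 * (1 / 2) ^ j) \<le> 16 * inverse r * l" by (simp add: mult_ac)
      qed (use assms in auto)
      also have "(16 * inverse r * l) ^ ?N = 16 ^ ?N * inverse r ^ ?N * l ^ ?N"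
        by (simp only: power_mult_distrib)
      finally show "ennreal ((2 ^ Suc j) ^ ?N) * emeasure lebesgue (?B j)
          \<le> ennreal (16 ^ ?N * inverse r ^ ?N * l ^ ?N)" .
    qed
    also have "\<dots> = ennreal (l ^ ?N + real (Suc K) * (16 ^ ?N * inverse r ^ ?N * l ^ ?N))"
    proof -
      have "(\<Sum>j\<le>K. ennreal (16 ^ ?N * inverse r ^ ?N * l ^ ?N)) = ennreal (\<Sum>j\<le>K. 16 ^ ?N * inverse r ^ ?N * l ^ ?N)"
        by (rule sum_ennreal) (use assms r in auto)
      also have "(\<Sum>j\<le>K. 16 ^ ?N * inverse r ^ ?N * l ^ ?N) = real (Suc K) * (16 ^ ?N * inverse r ^ ?N * l ^ ?N)"
        by (simp del: of_nat_Suc)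
      finally show ?thesis
        using assms r by (subst ennreal_plus) (auto simp del: of_nat_Suc)
    qed
    also have "\<dots> \<le> ennreal (3 * 16 ^ ?N * real K * inverse r ^ ?N * l ^ ?N)"
    proof (rule ennreal_leI)
      let ?X = "16 ^ ?N * inverse r ^ ?N :: real"
      have X: "1 \<le> ?X" using mult_mono[of 1 "16 ^ ?N" 1 "inverse r ^ ?N"] rN by simp
      \<comment> \<open>The \<open>K + 1\<close> layers and the extra 1 make at most
        \<open>K + 2\<close> copies of \<open>?X\<close>; the constant 3 comes from
        \<open>K + 2 \<le> 3 * K\<close>.\<close>
      have "1 + real (Suc K) * ?X \<le> ?X + real (Suc K) * ?X" using X by simp
      also have "\<dots> = (real K + 2) * ?X" by (simp add: algebra_simps)
      also have "\<dots> \<le> 3 * real K * ?X" using assms(2) X by (intro mult_right_mono) auto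
      finally have "(1 + real (Suc K) * ?X) * l ^ ?N \<le> 3 * real K * ?X * l ^ ?N"
        using assms by (intro mult_right_mono) auto
      then show "l ^ ?N + real (Suc K) * (16 ^ ?N * inverse r ^ ?N * l ^ ?N)
        \<le> 3 * 16 ^ ?N * real K * inverse r ^ ?N * l ^ ?N" by (simp add: algebra_simps)
    qed
    finally show ?thesis
      unfolding M_def[symmetric] r_def[symmetric] rp
      by (intro average_le[OF assms(1)]) (use r in auto)
  qed
qed

text \<open>A nonnegative power increases with the radius, so its value at the largest possible
  distance is a bound, without any factor \<open>K\<close>.\<close>

lemma average_regular_le:
  fixes a :: "real ^ 'n"
  assumes "0 < l" "0 \<le> s"
  shows "average (cube a l) (\<lambda>x. radius K x powr s) \<le> ennreal (clamp K (infnorm a + l) powr s)"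
proof (rule average_le_bound[OF assms(1)])
  fix x assume "x \<in> cube a l"
  then have "radius K x \<le> clamp K (infnorm a + l)"
    unfolding radius_def using infnorm_le_on_cube[of x a l] by (intro clamp_mono) linarith
  then show "radius K x powr s \<le> clamp K (infnorm a + l) powr s"
    using assms(2) by (intro powr_mono2) auto
qed simp

text \<open>The positive lower cutoff makes every real power of the radius continuous.\<close>

lemma weight_radius_powr: "weight (\<lambda>x::real ^ 'n. radius K x powr s)"
  unfolding weight_def
proof (intro conjI allI impI)
  fix B :: "(real ^ 'n) set" assume "compact B"
  then have "integrable lborel (\<lambda>x. indicator B x *\<^sub>R (radius K x powr s))"
    by (rule borel_integrable_compact) (rule continuous_on_radius_powr)
  then show "(\<lambda>x. radius K x powr s) absolutely_integrable_on B"
    unfolding set_integrable_def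
    by (subst integrable_completion) auto
qed simp

text \<open>Away from the origin the weight is constant.\<close>

lemma Apq_char_radius_ge_1: "1 \<le> Apq_char p q (\<lambda>x::real ^ 'n. radius K x powr s)"
proof -
  let ?w = "\<lambda>x::real ^ 'n. radius K x powr s"
  have 1: "radius K x = 1" if "x \<in> cube (vec 1) 1" for x :: "real ^ 'n"
  proof -
    have "1 \<le> infnorm x"
      using that component_le_infnorm_cart[of x undefined] unfolding cube_def
      by (auto intro: order_trans[OF _ order_trans[OF abs_ge_self]])
    then show ?thesis by (simp add: radius_def clamp_eq_1)
  qed
  have "average (cube (vec 1) 1) (\<lambda>x::real ^ 'n. ?w x powr t) = 1" for t
  proof -
    have "(\<integral>\<^sup>+x\<in>cube (vec 1) 1. ennreal (?w x powr t) \<partial>lebesgue) = (\<integral>\<^sup>+x. indicator (cube (vec 1) 1 :: (real ^ 'n) set) x \<partial>lebesgue)"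
      by (intro nn_integral_cong) (auto simp: indicator_def 1)
    also have "\<dots> = 1" by (simp add: emeasure_cube del: emeasure_completion)
    finally show ?thesis unfolding average_def by (simp add: emeasure_cube del: emeasure_completion)
  qed
  then have "1 = average (cube (vec 1) 1) (\<lambda>x. ?w x powr q) *
        average (cube (vec 1) 1) (\<lambda>x. ?w x powr (- dual_exp p)) epowr (q / dual_exp p)"
    by (simp add: epowr_def)
  also have "\<dots> \<le> Apq_char p q ?w"
    unfolding Apq_char_def by (rule SUP_upper2[of "(vec 1, 1)"]) auto
  finally show ?thesis .
qed

text \<open>The truncated size of the cube enters the first factor with exponent
  \<open>s * q\<close> and the second with
  \<open>- s * dual_exp p * (q / dual_exp p) = - s * q\<close>. These cancel, and only the constants
  remain.\<close>

lemma Apq_char_radius_le: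
  assumes "\<And>(a :: real ^ 'n) l. 0 < l \<Longrightarrow>
      average (cube a l) (\<lambda>x. radius K x powr (s * q)) \<le> ennreal (A * clamp K (infnorm a + l) powr (s * q))"
    and "\<And>(a :: real ^ 'n) l. 0 < l \<Longrightarrow>
      average (cube a l) (\<lambda>x. radius K x powr (- s * dual_exp p))
        \<le> ennreal (B * clamp K (infnorm a + l) powr (- s * dual_exp p))"
    and "0 \<le> A" "0 \<le> B" "1 < p" "0 < q"
  shows "Apq_char p q (\<lambda>x::real ^ 'n. radius K x powr s) \<le> ennreal (A * B powr (q / dual_exp p))"
  unfolding Apq_char_def
proof (rule SUP_least, clarify)
  fix a :: "real ^ 'n" and l :: real assume l: "0 < l"
  have d: "0 < dual_exp p" using assms by (simp add: dual_exp_def)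
  let ?r = "clamp K (infnorm a + l)"
  have "average (cube a l) (\<lambda>x. (radius K x powr s) powr q) \<le> ennreal (A * ?r powr (s * q))"
    using assms(1)[of l a] l by (simp add: powr_powr)
  moreover have "average (cube a l) (\<lambda>x. (radius K x powr s) powr (- dual_exp p)) epowr (q / dual_exp p)
      \<le> ennreal (B * ?r powr (- s * dual_exp p)) epowr (q / dual_exp p)"
    using assms(2)[of l a] l d assms(6) by (intro epowr_mono) (simp_all add: powr_powr)
  moreover have "ennreal (B * ?r powr (- s * dual_exp p)) epowr (q / dual_exp p)
      = ennreal (B powr (q / dual_exp p) * ?r powr (- s * q))"
    using assms d by (subst epowr_ennreal) (simp_all add: powr_mult powr_powr)
  ultimately have "average (cube a l) (\<lambda>x. (radius K x powr s) powr q) *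
        average (cube a l) (\<lambda>x. (radius K x powr s) powr (- dual_exp p)) epowr (q / dual_exp p)
      \<le> ennreal (A * ?r powr (s * q)) * ennreal (B powr (q / dual_exp p) * ?r powr (- s * q))"
    by (intro mult_mono) auto
  also have "\<dots> = ennreal (A * B powr (q / dual_exp p))"
  proof -
    have "?r powr (s * q) * ?r powr (- s * q) = 1"
      unfolding powr_add[symmetric] by (simp add: less_imp_neq[OF clamp_pos, symmetric])
    then have "(A * ?r powr (s * q)) * (B powr (q / dual_exp p) * ?r powr (- s * q)) = A * B powr (q / dual_exp p)"
      by (metis mult.assoc mult.left_commute mult.right_neutral)
    then show ?thesis using assms(3,4) by (subst ennreal_mult[symmetric]) auto
  qed
  finally show "average (cube a l) (\<lambda>x. (radius K x powr s) powr q) *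
        average (cube a l) (\<lambda>x. (radius K x powr s) powr (- dual_exp p)) epowr (q / dual_exp p)
      \<le> ennreal (A * B powr (q / dual_exp p))" .
qed

section \<open>Lower bounds for the operator norm\<close>

text \<open>On the unit cube the average is the integral and the truncated size is 1. The bound
  normalises the test functions.\<close>

lemma integral_singular_dcube_le:
  assumes "1 \<le> K"
  shows "(\<integral>\<^sup>+x\<in>dcube 0. ennreal (radius K (x :: real ^ 'n) powr (- real CARD('n))) \<partial>lebesgue)
    \<le> ennreal (3 * 16 ^ CARD('n) * real K)"
  using average_singular_le[of 1 K "0 :: real ^ 'n"] assms
  by (simp add: average_def emeasure_cube dcube_def clamp_eq_1 infnorm_0 divide_ennreal_def del: emeasure_completion)

text \<open>The shells are disjoint and each has at least half the volume of its cube, so pointwise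
  bounds on them add up.\<close>

lemma nn_integral_shells_ge:
  fixes g :: "real ^ 'n \<Rightarrow> ennreal"
  assumes "finite I" "\<And>j x. j \<in> I \<Longrightarrow> x \<in> shell j \<Longrightarrow> ennreal (c j) \<le> g x" "\<And>j. j \<in> I \<Longrightarrow> 0 \<le> c j"
  shows "ennreal (\<Sum>j\<in>I. c j * (((1 / 2) ^ j) ^ CARD('n) / 2)) \<le> (\<integral>\<^sup>+x. g x \<partial>lebesgue)"
proof -
  have "ennreal (\<Sum>j\<in>I. c j * (((1 / 2) ^ j) ^ CARD('n) / 2))
      = (\<Sum>j\<in>I. ennreal (c j) * ennreal (((1 / 2) ^ j) ^ CARD('n) / 2))"
    proof -
    have "ennreal (c j) * ennreal (((1 / 2) ^ j) ^ CARD('n) / 2) = ennreal (c j * (((1 / 2) ^ j) ^ CARD('n) / 2))"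
      if "j \<in> I" for j
      using assms(3)[OF that] by (subst ennreal_mult) auto
    then have "(\<Sum>j\<in>I. ennreal (c j) * ennreal (((1 / 2) ^ j) ^ CARD('n) / 2))
        = (\<Sum>j\<in>I. ennreal (c j * (((1 / 2) ^ j) ^ CARD('n) / 2)))"
      by (rule sum.cong[OF refl])
    also have "\<dots> = ennreal (\<Sum>j\<in>I. c j * (((1 / 2) ^ j) ^ CARD('n) / 2))"
      by (rule sum_ennreal) (use assms(3) in auto)
    finally show ?thesis ..
  qed
  also have "\<dots> \<le> (\<Sum>j\<in>I. ennreal (c j) * emeasure lebesgue (shell j :: (real ^ 'n) set))"
    by (intro sum_mono mult_left_mono emeasure_shell_ge) simp
  also have "\<dots> = (\<integral>\<^sup>+x. (\<Sum>j\<in>I. ennreal (c j) * indicator (shell j) x) \<partial>(lebesgue :: (real ^ 'n) measure))"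
    by (simp add: nn_integral_sum nn_integral_cmult del: emeasure_completion)
  also have "\<dots> \<le> (\<integral>\<^sup>+x. g x \<partial>lebesgue)"
  proof (rule nn_integral_mono)
    fix x :: "real ^ 'n"
    show "(\<Sum>j\<in>I. ennreal (c j) * indicator (shell j) x) \<le> g x"
    proof (cases "\<exists>j\<in>I. x \<in> shell j")
      case True
      then obtain j where j: "j \<in> I" "x \<in> shell j" by blast
      have ind: "indicator (shell i) x = (if i = j then 1 else 0 :: ennreal)" for i
        using j disjoint_family_shell unfolding disjoint_family_on_def indicator_def by auto
      have "(\<Sum>i\<in>I. ennreal (c i) * indicator (shell i) x) = (\<Sum>i\<in>I. if i = j then ennreal (c i) else 0)"
        by (intro sum.cong refl) (subst ind, simp)
      also have "\<dots> = ennreal (c j)" using j assms(1) by simp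
      finally have "(\<Sum>i\<in>I. ennreal (c i) * indicator (shell i) x) = ennreal (c j)" .
      then show ?thesis using assms(2)[OF j] by simp
    qed (simp add: indicator_def)
  qed
  finally show ?thesis .
qed

lemma radius_dcube_powr_ge:
  assumes "x \<in> dcube k" "k \<le> K" "0 \<le> s"
  shows "2 powr (real k * s) \<le> radius K x powr (- s)"
proof -
  have "((1 / 2) ^ k) powr (- s) \<le> radius K x powr (- s)"
    using radius_dcube_le[OF assms(1,2)] assms(3) by (intro powr_mono2') auto
  also have "((1 / 2) ^ k :: real) = 2 powr (- real k)"
    by (simp add: powr_minus powr_realpow power_one_over inverse_eq_divide)
  finally show ?thesis by (simp add: powr_powr)
qed

lemma half_power_card: "((1 / 2 :: real) ^ k) ^ N = 2 powr (- (real k * real N))"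
  by (simp add: powr_minus powr_realpow power_one_over inverse_eq_divide flip: power_mult of_nat_mult)

text \<open>At the critical exponent the growth of the power cancels the decay of the volume: each
  of the \<open>K - k\<close> shells in \<open>dcube k\<close> before the cutoff contributes at
  least \<open>1 / 2\<close>.\<close>

lemma integral_singular_dcube_ge:
  assumes "k \<le> K"
  shows "ennreal (real (K - k) / 2)
    \<le> (\<integral>\<^sup>+x\<in>dcube k. ennreal (radius K (x :: real ^ 'n) powr (- real CARD('n))) \<partial>lebesgue)"
proof -
  have "ennreal (\<Sum>j\<in>{k..<K}. 2 powr (real j * real CARD('n)) * (((1 / 2) ^ j) ^ CARD('n) / 2))
    \<le> (\<integral>\<^sup>+x\<in>dcube k. ennreal (radius K (x :: real ^ 'n) powr (- real CARD('n))) \<partial>lebesgue)"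
  proof (rule nn_integral_shells_ge)
    fix j and x :: "real ^ 'n" assume j: "j \<in> {k..<K}" and x: "x \<in> shell j"
    then have "x \<in> dcube j" "x \<in> dcube k" using dcube_antimono[of k j] by (auto simp: shell_def)
    then show "ennreal (2 powr (real j * real CARD('n)))
        \<le> ennreal (radius K x powr (- real CARD('n))) * indicator (dcube k) x"
      using radius_dcube_powr_ge[of x j K "real CARD('n)"] j by (auto intro: ennreal_leI)
  qed auto
  also have "(\<Sum>j\<in>{k..<K}. 2 powr (real j * real CARD('n)) * (((1 / 2) ^ j) ^ CARD('n) / 2)) = real (K - k) / 2"
    unfolding half_power_card times_divide_eq_right powr_add[symmetric] by simp
  finally show ?thesis .
qed

text \<open>Equally large terms gain the square root of their number. A singleton \<open>F\<close>
  amounts to keeping one term of the square function.\<close>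

lemma sparse_op_ge:
  assumes "finite F" "F \<subseteq> S" "0 \<le> b" "\<And>Q. Q \<in> F \<Longrightarrow> x \<in> Q"
    and "\<And>Q. Q \<in> F \<Longrightarrow> ennreal b \<le> ennreal (measure lebesgue Q powr (- \<alpha>)) * (\<integral>\<^sup>+y\<in>Q. f y \<partial>lebesgue)"
  shows "ennreal (sqrt (real (card F)) * b) \<le> sparse_op \<alpha> S f x"
proof -
  let ?g = "\<lambda>Q. (ennreal (measure lebesgue Q powr (- \<alpha>)) * (\<integral>\<^sup>+y\<in>Q. f y \<partial>lebesgue))\<^sup>2 * indicator Q x"
  have "ennreal (real (card F) * b\<^sup>2) = (\<Sum>Q\<in>F. (ennreal b)\<^sup>2)"
    using assms(3) by (simp add: ennreal_mult ennreal_power ennreal_of_nat_eq_real_of_nat)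
  also have "\<dots> \<le> (\<Sum>Q\<in>F. ?g Q)"
  proof (rule sum_mono)
    fix Q assume Q: "Q \<in> F"
    then show "(ennreal b)\<^sup>2 \<le> ?g Q"
      using power_mono[OF assms(5)[OF Q], of 2] assms(4)[OF Q] by simp
  qed
  also have "\<dots> = (\<Sum>\<^sub>\<infinity>Q\<in>F. ?g Q)" using assms(1) by simp
  also have "\<dots> \<le> (\<Sum>\<^sub>\<infinity>Q\<in>S. ?g Q)"
    using assms(2) by (intro infsum_mono_neutral nonneg_summable_on_complete) auto
  finally have "ennreal (real (card F) * b\<^sup>2) epowr (1 / 2) \<le> sparse_op \<alpha> S f x"
    unfolding sparse_op_def by (intro epowr_mono) auto
  moreover have "(real (card F) * b\<^sup>2) powr (1 / 2) = sqrt (real (card F)) * b"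
    using assms(3) by (simp add: powr_half_sqrt real_sqrt_mult)
  ultimately show ?thesis using assms(3) by (simp add: epowr_ennreal)
qed

section \<open>Normalised test functions\<close>

text \<open>The restriction to the unit cube keeps the norm finite, as the radius is 1 far from the
  origin; \<open>\<kappa>\<close> is the normalising factor.\<close>

definition test_fun :: "nat \<Rightarrow> real \<Rightarrow> real \<Rightarrow> real ^ 'n \<Rightarrow> ennreal" where
  "test_fun K \<kappa> s x = ennreal (\<kappa> * radius K x powr s) * indicator (dcube 0) x"

lemma test_fun_measurable: "test_fun K \<kappa> s \<in> borel_measurable lebesgue"
  unfolding test_fun_def by measurable

text \<open>The exponents are balanced so that \<open>f\<^sup>p w\<^sup>p\<close> is a multiple of the critical power of the radius.\<close>

lemma wnorm_test_fun_le_1: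
  assumes "1 \<le> K" "1 < p" "p * (s + t) = - real CARD('n)"
    and "\<kappa> = (3 * 16 ^ CARD('n) * real K) powr (- 1 / p)"
  shows "wnorm p (\<lambda>x. (radius K x powr t) powr p) (test_fun K \<kappa> s :: real ^ 'n \<Rightarrow> ennreal) \<le> 1"
proof -
  let ?C = "3 * 16 ^ CARD('n) * real K"
  have C: "0 < ?C" using assms(1) by simp
  have \<kappa>: "\<kappa> powr p * ?C = 1"
  proof -
    have "\<kappa> powr p = ?C powr (- 1)" using assms(2) unfolding assms(4) powr_powr by simp
    moreover have "c powr (- 1) * c = 1" if "0 < c" for c :: real using that by (simp add: powr_minus)
    ultimately show ?thesis using C by metis
  qed
  have "(\<integral>\<^sup>+x. test_fun K \<kappa> s (x :: real ^ 'n) epowr p * ennreal ((radius K x powr t) powr p) \<partial>lebesgue)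
      = (\<integral>\<^sup>+x. ennreal (\<kappa> powr p) * (ennreal (radius K (x :: real ^ 'n) powr (- real CARD('n))) * indicator (dcube 0) x) \<partial>lebesgue)"
  proof (rule nn_integral_cong)
    fix x :: "real ^ 'n"
    have "(\<kappa> * radius K x powr s) powr p * (radius K x powr t) powr p
        = \<kappa> powr p * radius K x powr (p * (s + t))"
      using assms(4) by (simp add: powr_mult powr_powr distrib_left powr_add mult.commute)
    then show "test_fun K \<kappa> s x epowr p * ennreal ((radius K x powr t) powr p)
      = ennreal (\<kappa> powr p) * (ennreal (radius K x powr (- real CARD('n))) * indicator (dcube 0) x)"
      using assms(2,3,4)
      by (auto simp: test_fun_def indicator_def epowr_ennreal ennreal_mult[symmetric])
        (simp add: epowr_def)
  qed
  also have "\<dots> = ennreal (\<kappa> powr p) * (\<integral>\<^sup>+x\<in>dcube 0. ennreal (radius K (x :: real ^ 'n) powr (- real CARD('n))) \<partial>lebesgue)"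
    by (rule nn_integral_cmult) measurable
  also have "\<dots> \<le> ennreal (\<kappa> powr p) * ennreal ?C"
    by (rule mult_left_mono[OF integral_singular_dcube_le[OF assms(1)]]) simp
  also have "\<dots> = 1" using \<kappa> C by (simp add: ennreal_mult[symmetric])
  finally have "wnorm p (\<lambda>x. (radius K x powr t) powr p) (test_fun K \<kappa> s :: real ^ 'n \<Rightarrow> ennreal) \<le> 1 epowr (1 / p)"
    unfolding wnorm_def using assms(2) by (intro epowr_mono) auto
  then show ?thesis by (simp add: epowr_def)
qed

lemma sparse_op_norm_ge:
  assumes "f \<in> borel_measurable lebesgue" "wnorm p (\<lambda>x. w x powr p) f \<le> 1" "0 \<le> X" "0 < q"
    and "ennreal X \<le> (\<integral>\<^sup>+x. sparse_op \<alpha> S f x epowr q * ennreal (w x powr q) \<partial>lebesgue)"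
  shows "ennreal (X powr (1 / q)) \<le> sparse_op_norm \<alpha> S p q w"
proof -
  have "ennreal (X powr (1 / q)) = ennreal X epowr (1 / q)" using assms(3) by (simp add: epowr_ennreal)
  also have "\<dots> \<le> wnorm q (\<lambda>x. w x powr q) (sparse_op \<alpha> S f)"
    unfolding wnorm_def using assms(4,5) by (intro epowr_mono) auto
  also have "\<dots> \<le> sparse_op_norm \<alpha> S p q w"
    unfolding sparse_op_norm_def using assms(1,2) by (intro SUP_upper) auto
  finally show ?thesis .
qed

lemma measure_dcube_powr: "measure lebesgue (dcube k :: (real ^ 'n) set) powr (- \<alpha>) = 2 powr (real k * real CARD('n) * \<alpha>)"
  unfolding measure_dcube half_power_card by (simp add: powr_powr)

text \<open>Every \<open>dcube k\<close> lies in the unit cube, so the indicator in the test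
  function has no effect there.\<close>

lemma integral_test_fun:
  assumes "0 \<le> \<kappa>"
  shows "(\<integral>\<^sup>+y\<in>dcube k. test_fun K \<kappa> s (y :: real ^ 'n) \<partial>lebesgue)
    = ennreal \<kappa> * (\<integral>\<^sup>+y\<in>dcube k. ennreal (radius K (y :: real ^ 'n) powr s) \<partial>lebesgue)"
proof -
  have "(\<integral>\<^sup>+y\<in>dcube k. test_fun K \<kappa> s (y :: real ^ 'n) \<partial>lebesgue)
    = (\<integral>\<^sup>+y. ennreal \<kappa> * (ennreal (radius K (y :: real ^ 'n) powr s) * indicator (dcube k) y) \<partial>lebesgue)"
    using dcube_antimono[of 0 k, where 'a = 'n] assms
    by (intro nn_integral_cong) (auto simp: test_fun_def indicator_def ennreal_mult)
  then show ?thesis by (simp add: nn_integral_cmult)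
qed

section \<open>Testing the operator on the two families of weights\<close>

text \<open>On each shell with \<open>k < K\<close> the term of \<open>dcube k\<close> alone is of
  order \<open>\<kappa> * K\<close> times a power of \<open>2 ^ k\<close>. After the weight and the
  volume of the shell are included, the dependence on \<open>k\<close> disappears, and
  \<open>K\<close> equal contributions remain.\<close>

lemma sparse_op_norm_ge_vanishing_weight:
  fixes K :: nat
  assumes p: "1 < p" "p \<le> q" and \<alpha>: "1 / q + 1 / dual_exp p = \<alpha>" and K: "1 \<le> K"
  defines "w \<equiv> \<lambda>x::real ^ 'n. radius (2 * K) x powr (real CARD('n) / dual_exp p)"
  shows "ennreal ((6 * 16 ^ CARD('n)) powr (- 1 / p) / 2 * (1 / (2 * 2 powr (real CARD('n) * q / dual_exp p))) powr (1 / q)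
            * real K powr \<alpha>) \<le> sparse_op_norm \<alpha> (range dcube) p q w"
proof -
  let ?N = "real CARD('n)"
  define d where "d = dual_exp p"
  have d: "0 < d" "1 / p + 1 / d = 1" using p by (auto simp: d_def dual_exp_def field_simps)
  have \<alpha>q: "\<alpha> * q = 1 + q / d" using \<alpha> p unfolding d_def[symmetric] by (auto simp: field_simps)
  define \<kappa> where "\<kappa> = (3 * 16 ^ CARD('n) * real (2 * K)) powr (- 1 / p)"
  have \<kappa>: "0 < \<kappa>" using K by (simp add: \<kappa>_def)
  have \<kappa>2: "\<kappa> = (6 * 16 ^ CARD('n)) powr (- 1 / p) * real K powr (- 1 / p)"
    unfolding \<kappa>_def powr_mult[symmetric] by (simp add: mult_ac)
  define f where "f = (test_fun (2 * K) \<kappa> (- ?N) :: real ^ 'n \<Rightarrow> ennreal)"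
  have "p * (- ?N + ?N / d) = - ?N * (p * (1 - 1 / d))" by (simp add: algebra_simps)
  also have "\<dots> = - ?N" proof -
    have "1 - 1 / d = 1 / p" using d by simp
    then show ?thesis using p by simp
  qed
  finally have f1: "wnorm p (\<lambda>x. w x powr p) f \<le> 1"
    unfolding f_def w_def d_def[symmetric] by (intro wnorm_test_fun_le_1) (use K p in \<open>auto simp: \<kappa>_def\<close>)
  define b where "b k = 2 powr (real k * ?N * \<alpha>) * (\<kappa> * (real K / 2))" for k :: nat
  have b: "0 \<le> b k" for k using \<kappa> by (simp add: b_def)
  have A: "ennreal (b k) \<le> sparse_op \<alpha> (range dcube) f x" if x: "x \<in> dcube k" and k: "k < K" for k x
  proof -
    have "ennreal (b k) = ennreal (2 powr (real k * ?N * \<alpha>)) * (ennreal \<kappa> * ennreal (real K / 2))"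
      proof -
      have "0 \<le> real K / 2" "0 \<le> \<kappa>" using \<kappa> by auto
      then show ?thesis unfolding b_def
        using ennreal_mult[of \<kappa> "real K / 2"] ennreal_mult[of "2 powr (real k * ?N * \<alpha>)" "\<kappa> * (real K / 2)"]
        by (metis mult_nonneg_nonneg powr_ge_zero)
    qed
    also have "\<dots> \<le> ennreal (2 powr (real k * ?N * \<alpha>)) * (ennreal \<kappa> *
        (\<integral>\<^sup>+y\<in>dcube k. ennreal (radius (2 * K) (y :: real ^ 'n) powr (- ?N)) \<partial>lebesgue))"
    proof (intro mult_left_mono)
      \<comment> \<open>The truncation level is \<open>2 * K\<close>, so each \<open>dcube k\<close>
        with \<open>k < K\<close> still contains at least \<open>K\<close> shells before the
        cutoff.\<close>
      have "ennreal (real K / 2) \<le> ennreal (real (2 * K - k) / 2)" using k by (intro ennreal_leI) simp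
      also have "\<dots> \<le> (\<integral>\<^sup>+y\<in>dcube k. ennreal (radius (2 * K) (y :: real ^ 'n) powr (- ?N)) \<partial>lebesgue)"
        by (rule integral_singular_dcube_ge) (use k in simp)
      finally show "ennreal (real K / 2) \<le> \<dots>" .
    qed auto
    also have "\<dots> = ennreal (measure lebesgue (dcube k :: (real ^ 'n) set) powr (- \<alpha>)) * (\<integral>\<^sup>+y\<in>dcube k. f y \<partial>lebesgue)"
      unfolding f_def using \<kappa> by (simp add: integral_test_fun measure_dcube_powr)
    finally have "ennreal (sqrt (real (card {dcube k :: (real ^ 'n) set})) * b k) \<le> sparse_op \<alpha> (range dcube) f x"
      using b x by (intro sparse_op_ge) auto
    then show ?thesis by simp
  qed
  define c where "c k = b k powr q * 2 powr (- (real (Suc k) * (?N * q / d)))" for k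
  have I: "ennreal (\<Sum>k\<in>{..<K}. c k * (((1 / 2) ^ k) ^ CARD('n) / 2))
      \<le> (\<integral>\<^sup>+x. sparse_op \<alpha> (range dcube) f x epowr q * ennreal (w x powr q) \<partial>lebesgue)"
  proof (rule nn_integral_shells_ge)
    fix k and x :: "real ^ 'n" assume k: "k \<in> {..<K}" and x: "x \<in> shell k"
    \<comment> \<open>The weight decreases towards the origin, so the inner edge of the shell
      counts. Passing from \<open>k\<close> to \<open>Suc k\<close> costs the factor
      \<open>2 powr (?N * q / d)\<close> in the final constant.\<close>
    have "((1 / 2) ^ Suc k) powr (?N * q / d) \<le> radius (2 * K) x powr (?N * q / d)"
      using radius_shell_ge[OF x] d p by (intro powr_mono2) auto
    also have "((1 / 2) ^ Suc k :: real) = 2 powr (- real (Suc k))"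
      by (simp add: powr_minus powr_realpow power_one_over inverse_eq_divide del: power_Suc of_nat_Suc)
    finally have "2 powr (- real (Suc k) * (?N * q / d)) \<le> radius (2 * K) x powr (?N * q / d)"
      unfolding powr_powr .
    moreover have "w x powr q = radius (2 * K) x powr (?N * q / d)"
      unfolding w_def d_def[symmetric] by (simp add: powr_powr)
    ultimately have "2 powr (- (real (Suc k) * (?N * q / d))) \<le> w x powr q"
      by (simp only: minus_mult_left)
    moreover have "ennreal (b k powr q) \<le> sparse_op \<alpha> (range dcube) f x epowr q"
      using epowr_mono[OF A, of x k q] x k p b by (auto simp: epowr_ennreal shell_def)
    ultimately have "ennreal (b k powr q) * ennreal (2 powr (- (real (Suc k) * (?N * q / d))))
        \<le> sparse_op \<alpha> (range dcube) f x epowr q * ennreal (w x powr q)"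
      by (intro mult_mono) (auto intro: ennreal_leI)
    then show "ennreal (c k) \<le> sparse_op \<alpha> (range dcube) f x epowr q * ennreal (w x powr q)"
      by (simp add: c_def ennreal_mult)
  qed (auto simp: c_def)
  have T: "c k * (((1 / 2) ^ k) ^ CARD('n) / 2) = (\<kappa> * (real K / 2)) powr q / (2 * 2 powr (?N * q / d))" for k
  proof -
    \<comment> \<open>The exponents of 2 come from the sparse operator, the weight and the volume;
      by \<open>\<alpha> * q = 1 + q / d\<close> the coefficient of \<open>k\<close> is
      zero.\<close>
    have "real k * ?N * \<alpha> * q + - (real (Suc k) * (?N * q / d)) + - (real k * ?N)
        = real k * ?N * (\<alpha> * q - 1 - q / d) - ?N * q / d" by (simp add: algebra_simps add_divide_distrib)
    then have e: "real k * ?N * \<alpha> * q + - (real (Suc k) * (?N * q / d)) + - (real k * ?N) = - (?N * q / d)"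
      using \<alpha>q by simp
    have "c k * (((1 / 2) ^ k) ^ CARD('n) / 2)
      = (\<kappa> * (real K / 2)) powr q / 2 * (2 powr (real k * ?N * \<alpha> * q) * 2 powr (- (real (Suc k) * (?N * q / d))) * 2 powr (- (real k * ?N)))"
    proof -
      have "b k powr q = 2 powr (real k * ?N * \<alpha> * q) * (\<kappa> * (real K / 2)) powr q"
        unfolding b_def powr_powr[symmetric] by (rule powr_mult)
      then show ?thesis unfolding c_def half_power_card by (simp only: mult_ac times_divide_eq_right times_divide_eq_left)
    qed
    also have "\<dots> = (\<kappa> * (real K / 2)) powr q / 2 * 2 powr (- (?N * q / d))"
      unfolding powr_add[symmetric] e ..
    finally show ?thesis by (simp add: powr_minus_divide)
  qed
  have "(\<Sum>k\<in>{..<K}. c k * (((1 / 2) ^ k) ^ CARD('n) / 2))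
      = real K * (\<kappa> * (real K / 2)) powr q / (2 * 2 powr (?N * q / d))"
    unfolding T sum_constant by simp
  then have "ennreal (real K * (\<kappa> * (real K / 2)) powr q / (2 * 2 powr (?N * q / d)))
      \<le> (\<integral>\<^sup>+x. sparse_op \<alpha> (range dcube) f x epowr q * ennreal (w x powr q) \<partial>lebesgue)"
    using I by metis
  then have "ennreal ((real K * (\<kappa> * (real K / 2)) powr q / (2 * 2 powr (?N * q / d))) powr (1 / q))
      \<le> sparse_op_norm \<alpha> (range dcube) p q w"
    by (rule sparse_op_norm_ge[rotated 4]) (use f1 p in \<open>auto simp: f_def test_fun_measurable\<close>)
  moreover have "(real K * (\<kappa> * (real K / 2)) powr q / (2 * 2 powr (?N * q / d))) powr (1 / q)
    = (6 * 16 ^ CARD('n)) powr (- 1 / p) / 2 * (1 / (2 * 2 powr (?N * q / d))) powr (1 / q) * real K powr \<alpha>"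
  proof -
    have "(real K * (\<kappa> * (real K / 2)) powr q / (2 * 2 powr (?N * q / d))) powr (1 / q)
      = (real K * (1 / (2 * 2 powr (?N * q / d))) * (\<kappa> * (real K / 2)) powr q) powr (1 / q)" by simp
    also have "\<dots> = real K powr (1 / q) * (1 / (2 * 2 powr (?N * q / d))) powr (1 / q) * (\<kappa> * (real K / 2))"
      using p \<kappa> by (simp only: powr_mult powr_powr) simp
    also have "\<dots> = (6 * 16 ^ CARD('n)) powr (- 1 / p) / 2 * (1 / (2 * 2 powr (?N * q / d))) powr (1 / q)
        * (real K powr (1 / q) * real K powr (- 1 / p) * real K powr 1)"
      unfolding \<kappa>2 using K by (simp add: mult_ac)
    \<comment> \<open>The exponent \<open>1 / q\<close> comes from the number of shells,
      \<open>- 1 / p\<close> from the normalisation and 1 from the integral of the test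
      function.\<close>
    also have "real K powr (1 / q) * real K powr (- 1 / p) * real K powr 1 = real K powr \<alpha>"
    proof -
      have "1 / q + - 1 / p + 1 = \<alpha>" using \<alpha> d unfolding d_def[symmetric] by simp
      then show ?thesis unfolding powr_add[symmetric] by simp
    qed
    finally show ?thesis .
  qed
  ultimately show ?thesis unfolding d_def by metis
qed

text \<open>On \<open>dcube K\<close> all the cubes \<open>dcube k\<close> with \<open>k < K\<close>
  give terms of size at least \<open>\<kappa>\<close>, so the square function gains
  \<open>sqrt K\<close>. The weight to the power \<open>q\<close> is critical and has mass at least
  \<open>K / 2\<close> on \<open>dcube K\<close>.\<close>

lemma sparse_op_norm_ge_singular_weight:
  fixes K :: nat
  assumes p: "1 < p" "p \<le> q" and \<alpha>: "1 / q + 1 / dual_exp p = \<alpha>" "\<alpha> < 1" and K: "1 \<le> K"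
  defines "w \<equiv> \<lambda>x::real ^ 'n. radius (2 * K) x powr (- (real CARD('n) / q))"
  shows "ennreal ((6 * 16 ^ CARD('n)) powr (- 1 / p) * (1 / 2) powr (1 / q) * real K powr (\<alpha> - 1 / 2))
     \<le> sparse_op_norm \<alpha> (range dcube) p q w"
proof -
  let ?N = "real CARD('n)"
  have d: "1 / p - 1 / q = 1 - \<alpha>" using p \<alpha>(1) by (auto simp: dual_exp_def field_simps)
  define \<kappa> where "\<kappa> = (3 * 16 ^ CARD('n) * real (2 * K)) powr (- 1 / p)"
  have \<kappa>: "0 < \<kappa>" using K by (simp add: \<kappa>_def)
  have \<kappa>2: "\<kappa> = (6 * 16 ^ CARD('n)) powr (- 1 / p) * real K powr (- 1 / p)"
    unfolding \<kappa>_def powr_mult[symmetric] by (simp add: mult_ac)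
  define s where "s = ?N * (1 - \<alpha>)"
  have s: "0 \<le> s" using \<alpha> by (simp add: s_def)
  define f where "f = (test_fun (2 * K) \<kappa> (- s) :: real ^ 'n \<Rightarrow> ennreal)"
  \<comment> \<open>As \<open>1 - \<alpha> = 1 / p - 1 / q\<close>, the exponents satisfy
    \<open>s + ?N / q = ?N / p\<close>, the balance that the normalisation asks for.\<close>
  have "p * (- s + - (?N / q)) = - ?N"
    unfolding s_def d[symmetric] using p by (simp add: field_simps)
  then have f1: "wnorm p (\<lambda>x. w x powr p) f \<le> 1"
    unfolding f_def w_def by (intro wnorm_test_fun_le_1) (use K p in \<open>auto simp: \<kappa>_def\<close>)
  have A: "ennreal (sqrt (real K) * \<kappa>) \<le> sparse_op \<alpha> (range dcube) f x" if x: "x \<in> dcube K" for x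
  proof -
    have "ennreal (sqrt (real (card (dcube ` {..<K} :: (real ^ 'n) set set))) * \<kappa>) \<le> sparse_op \<alpha> (range dcube) f x"
    proof (rule sparse_op_ge)
      fix Q :: "(real ^ 'n) set" assume "Q \<in> dcube ` {..<K}"
      then obtain k where k: "k < K" "Q = dcube k" by auto
      then show "x \<in> Q" using x dcube_antimono[of k K] by auto
      \<comment> \<open>The choice of \<open>s\<close> makes the powers of 2 cancel:
        \<open>?N * \<alpha> + s - ?N = 0\<close>.\<close>
      have "ennreal \<kappa> = ennreal (2 powr (real k * ?N * \<alpha>)) * (ennreal \<kappa> * (ennreal (2 powr (real k * s)) * ennreal (2 powr (- (real k * ?N)))))"
        using \<kappa> by (simp add: ennreal_mult[symmetric] powr_add[symmetric] s_def algebra_simps)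
      also have "ennreal (2 powr (real k * s)) * ennreal (2 powr (- (real k * ?N)))
          = (\<integral>\<^sup>+y. ennreal (2 powr (real k * s)) * indicator (dcube k :: (real ^ 'n) set) y \<partial>lebesgue)"
        by (simp add: nn_integral_cmult emeasure_dcube half_power_card del: emeasure_completion)
      also have "ennreal (2 powr (real k * ?N * \<alpha>)) * (ennreal \<kappa> * \<dots>)
          \<le> ennreal (2 powr (real k * ?N * \<alpha>)) * (ennreal \<kappa> *
          (\<integral>\<^sup>+y\<in>dcube k. ennreal (radius (2 * K) (y :: real ^ 'n) powr (- s)) \<partial>lebesgue))"
        using radius_dcube_powr_ge[of _ k "2 * K" s] k s
        by (intro mult_left_mono nn_integral_mono) (auto simp: indicator_def intro: ennreal_leI)
      also have "\<dots> = ennreal (measure lebesgue Q powr (- \<alpha>)) * (\<integral>\<^sup>+y\<in>Q. f y \<partial>lebesgue)"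
        unfolding f_def k(2) using \<kappa> by (simp add: integral_test_fun measure_dcube_powr)
      finally show "ennreal \<kappa> \<le> \<dots>" .
    qed (use \<kappa> in auto)
    moreover have "card (dcube ` {..<K} :: (real ^ 'n) set set) = K"
      by (simp add: card_image inj_on_subset[OF inj_dcube subset_UNIV])
    ultimately show ?thesis by simp
  qed
  \<comment> \<open>Truncating at \<open>2 * K\<close> leaves \<open>K\<close> shells inside
    \<open>dcube K\<close>, whence the mass \<open>K / 2\<close>.\<close>
  have "ennreal ((sqrt (real K) * \<kappa>) powr q * (real K / 2))
      = ennreal ((sqrt (real K) * \<kappa>) powr q) * ennreal (real (2 * K - K) / 2)"
    by (subst ennreal_mult) auto
  also have "\<dots> \<le> ennreal ((sqrt (real K) * \<kappa>) powr q) *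
      (\<integral>\<^sup>+x\<in>dcube K. ennreal (radius (2 * K) (x :: real ^ 'n) powr (- ?N)) \<partial>lebesgue)"
    by (intro mult_left_mono integral_singular_dcube_ge) auto
  also have "\<dots> = (\<integral>\<^sup>+x. ennreal ((sqrt (real K) * \<kappa>) powr q) *
      (ennreal (radius (2 * K) (x :: real ^ 'n) powr (- ?N)) * indicator (dcube K) x) \<partial>lebesgue)"
    by (rule nn_integral_cmult[symmetric]) measurable
  also have "\<dots> \<le> (\<integral>\<^sup>+x. sparse_op \<alpha> (range dcube) f x epowr q * ennreal (w x powr q) \<partial>lebesgue)"
  proof (rule nn_integral_mono)
    fix x :: "real ^ 'n"
    have "w x powr q = radius (2 * K) x powr (- ?N)" unfolding w_def using p by (simp add: powr_powr)
    moreover have "ennreal ((sqrt (real K) * \<kappa>) powr q) \<le> sparse_op \<alpha> (range dcube) f x epowr q" if "x \<in> dcube K"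
      using epowr_mono[OF A[OF that], of q] p \<kappa> by (simp add: epowr_ennreal)
    ultimately show "ennreal ((sqrt (real K) * \<kappa>) powr q) *
      (ennreal (radius (2 * K) x powr (- ?N)) * indicator (dcube K) x)
      \<le> sparse_op \<alpha> (range dcube) f x epowr q * ennreal (w x powr q)"
      by (auto simp: indicator_def intro: mult_right_mono)
  qed
  finally have "ennreal (((sqrt (real K) * \<kappa>) powr q * (real K / 2)) powr (1 / q))
      \<le> sparse_op_norm \<alpha> (range dcube) p q w"
    using f1 p by (intro sparse_op_norm_ge[of f]) (auto simp: f_def test_fun_measurable)
  moreover have "((sqrt (real K) * \<kappa>) powr q * (real K / 2)) powr (1 / q)
    = (6 * 16 ^ CARD('n)) powr (- 1 / p) * (1 / 2) powr (1 / q) * real K powr (\<alpha> - 1 / 2)"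
  proof -
    have "((sqrt (real K) * \<kappa>) powr q * (real K / 2)) powr (1 / q)
      = ((sqrt (real K) * \<kappa>) powr q * (real K * (1 / 2))) powr (1 / q)" by simp
    also have "\<dots> = sqrt (real K) * \<kappa> * (real K powr (1 / q) * (1 / 2) powr (1 / q))"
      using p \<kappa> by (simp only: powr_mult powr_powr) simp
    also have "\<dots> = (6 * 16 ^ CARD('n)) powr (- 1 / p) * (1 / 2) powr (1 / q)
        * (real K powr (1 / 2) * real K powr (- 1 / p) * real K powr (1 / q))"
      unfolding \<kappa>2 by (simp add: mult_ac powr_half_sqrt)
    also have "real K powr (1 / 2) * real K powr (- 1 / p) * real K powr (1 / q) = real K powr (\<alpha> - 1 / 2)"
    proof -
      have "1 / 2 + - 1 / p + 1 / q = \<alpha> - 1 / 2" using d by simp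
      then show ?thesis unfolding powr_add[symmetric] by (simp only:)
    qed
    finally show ?thesis .
  qed
  ultimately show ?thesis by metis
qed

section \<open>Growth of the bounding function\<close>

text \<open>The weight to the power \<open>q\<close> is a nonnegative power of the radius and costs
  nothing; the dual weight is critical, so its factor \<open>K\<close> is raised to
  \<open>q / dual_exp p\<close>.\<close>

lemma Apq_char_vanishing_weight_le:
  assumes "1 < p" "0 < q" "1 \<le> K"
  shows "Apq_char p q (\<lambda>x::real ^ 'n. radius K x powr (real CARD('n) / dual_exp p))
    \<le> ennreal ((3 * 16 ^ CARD('n) * real K) powr (q / dual_exp p))"
proof -
  have d: "0 < dual_exp p" using assms by (simp add: dual_exp_def)
  have "Apq_char p q (\<lambda>x::real ^ 'n. radius K x powr (real CARD('n) / dual_exp p))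
    \<le> ennreal (1 * (3 * 16 ^ CARD('n) * real K) powr (q / dual_exp p))"
  proof (rule Apq_char_radius_le)
    fix a :: "real ^ 'n" and l :: real assume l: "0 < l"
    show "average (cube a l) (\<lambda>x. radius K x powr (real CARD('n) / dual_exp p * q))
      \<le> ennreal (1 * clamp K (infnorm a + l) powr (real CARD('n) / dual_exp p * q))"
      using average_regular_le[OF l, of "real CARD('n) / dual_exp p * q" a K] d assms by simp
    show "average (cube a l) (\<lambda>x. radius K x powr (- (real CARD('n) / dual_exp p) * dual_exp p))
      \<le> ennreal (3 * 16 ^ CARD('n) * real K * clamp K (infnorm a + l) powr (- (real CARD('n) / dual_exp p) * dual_exp p))"
      using average_singular_le[OF l assms(3), of a] d by simp
  qed (use assms in auto)
  then show ?thesis by simp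
qed

text \<open>The roles are exchanged: the critical power sits in the first average, so
  \<open>K\<close> enters linearly.\<close>

lemma Apq_char_singular_weight_le:
  assumes "1 < p" "0 < q" "1 \<le> K"
  shows "Apq_char p q (\<lambda>x::real ^ 'n. radius K x powr (- (real CARD('n) / q)))
    \<le> ennreal (3 * 16 ^ CARD('n) * real K)"
proof -
  have d: "0 < dual_exp p" using assms by (simp add: dual_exp_def)
  have "Apq_char p q (\<lambda>x::real ^ 'n. radius K x powr (- (real CARD('n) / q)))
    \<le> ennreal (3 * 16 ^ CARD('n) * real K * 1 powr (q / dual_exp p))"
  proof (rule Apq_char_radius_le)
    fix a :: "real ^ 'n" and l :: real assume l: "0 < l"
    show "average (cube a l) (\<lambda>x. radius K x powr (- (real CARD('n) / q) * q))
      \<le> ennreal (3 * 16 ^ CARD('n) * real K * clamp K (infnorm a + l) powr (- (real CARD('n) / q) * q))"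
      using average_singular_le[OF l assms(3), of a] assms by simp
    show "average (cube a l) (\<lambda>x. radius K x powr (- (- (real CARD('n) / q)) * dual_exp p))
      \<le> ennreal (1 * clamp K (infnorm a + l) powr (- (- (real CARD('n) / q)) * dual_exp p))"
      using average_regular_le[OF l, of "real CARD('n) / q * dual_exp p" a K] d assms by simp
  qed (use assms in auto)
  then show ?thesis by simp
qed

section \<open>From samples at the characteristics to growth everywhere\<close>

text \<open>Given \<open>t\<close>, take the largest \<open>m\<close> with
  \<open>C * m powr a \<le> t\<close>. Then \<open>T m \<le> t\<close>, and monotonicity carries the
  lower bound from \<open>T m\<close> to \<open>t\<close>.\<close>

lemma power_growth_from_mono_samples:
  fixes \<Phi> :: "real \<Rightarrow> real" and T :: "nat \<Rightarrow> real"
  assumes pos: "\<forall>t\<ge>1. 0 < \<Phi> t" and mono: "mono_on {1..} \<Phi>"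
    and "0 < a" "0 < \<gamma>" "0 < c" "0 < C"
    and T: "\<And>m. 1 \<le> m \<Longrightarrow> 1 \<le> T m" "\<And>m. 1 \<le> m \<Longrightarrow> T m \<le> C * real m powr a"
    and lower: "\<And>m. 1 \<le> m \<Longrightarrow> c * real m powr (a * \<gamma>) \<le> \<Phi> (T m)"
  shows "\<exists>c>0. \<forall>t\<ge>1. c * t powr \<gamma> \<le> \<Phi> t"
proof -
  \<comment> \<open>The first entry serves \<open>t \<le> C\<close>, where \<open>\<Phi> 1\<close>
    is a lower bound; the second serves larger \<open>t\<close>, with
    \<open>2 powr (a * \<gamma>)\<close> paying for the rounding to an integer.\<close>
  define c' where "c' = min (\<Phi> 1 / C powr \<gamma>) (c / (2 powr (a * \<gamma>) * C powr \<gamma>))"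
  have "0 < c'" unfolding c'_def using assms by simp
  moreover have "c' * t powr \<gamma> \<le> \<Phi> t" if t: "1 \<le> t" for t
  proof (cases "t \<le> C")
    case True
    have "c' * t powr \<gamma> \<le> (\<Phi> 1 / C powr \<gamma>) * C powr \<gamma>"
      using True t assms(4) pos by (intro mult_mono powr_mono2) (auto simp: c'_def less_imp_le)
    also have "\<dots> = \<Phi> 1" using assms(6) by simp
    also have "\<dots> \<le> \<Phi> t" using mono t by (auto simp: mono_on_def)
    finally show ?thesis .
  next
    case False
    define y where "y = (t / C) powr (1 / a)"
    have y: "1 \<le> y" unfolding y_def using False assms(3,6) by (intro ge_one_powr_ge_zero) auto
    define m where "m = nat \<lfloor>y\<rfloor>"
    \<comment> \<open>Rounding down loses at most a factor 2 because
      \<open>1 \<le> y\<close>.\<close>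
    have m: "1 \<le> m" "real m \<le> y" "y \<le> 2 * real m"
    proof -
      have "1 \<le> \<lfloor>y\<rfloor>" using y by simp
      then have "real m = of_int \<lfloor>y\<rfloor>" "1 \<le> m" unfolding m_def by linarith+
      moreover have "1 \<le> real m" using \<open>1 \<le> m\<close> by simp
      ultimately show "1 \<le> m" "real m \<le> y" "y \<le> 2 * real m" by linarith+
    qed
    have ya: "y powr a = t / C" unfolding y_def powr_powr using assms(3,6) t by simp
    have "T m \<le> C * real m powr a" by (rule T(2)[OF m(1)])
    also have "\<dots> \<le> C * y powr a" using m assms(3,6) by (intro mult_left_mono powr_mono2) auto
    also have "\<dots> = t" using assms(6) by (simp add: ya)
    finally have "\<Phi> (T m) \<le> \<Phi> t" using mono T(1)[OF m(1)] t by (auto simp: mono_on_def)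
    have "(y / 2) powr (a * \<gamma>) = (t / C) powr \<gamma> / 2 powr (a * \<gamma>)"
      unfolding powr_divide ya[symmetric] powr_powr ..
    also have "\<dots> = t powr \<gamma> / (2 powr (a * \<gamma>) * C powr \<gamma>)" by (simp add: powr_divide)
    finally have e: "c * (y / 2) powr (a * \<gamma>) = c / (2 powr (a * \<gamma>) * C powr \<gamma>) * t powr \<gamma>" by simp
    have "c' * t powr \<gamma> \<le> c / (2 powr (a * \<gamma>) * C powr \<gamma>) * t powr \<gamma>"
      by (intro mult_right_mono) (simp_all add: c'_def)
    also have "\<dots> \<le> c * real m powr (a * \<gamma>)"
      unfolding e[symmetric] using m y assms(3,4,5) by (intro mult_left_mono powr_mono2) auto
    also have "\<dots> \<le> \<Phi> (T m)" by (rule lower[OF m(1)])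
    finally show ?thesis using \<open>\<Phi> (T m) \<le> \<Phi> t\<close> by linarith
  qed
  ultimately show ?thesis by blast
qed

text \<open>A nonincreasing function is bounded by \<open>\<Phi> 1\<close> on \<open>{1..}\<close>,
  while the sampled values tend to infinity.\<close>

lemma not_antimono_from_samples:
  fixes \<Phi> :: "real \<Rightarrow> real" and T :: "nat \<Rightarrow> real"
  assumes anti: "antimono_on {1..} \<Phi>" and "0 < b" "0 < c"
    and T: "\<And>m. 1 \<le> m \<Longrightarrow> 1 \<le> T m"
    and lower: "\<And>m. 1 \<le> m \<Longrightarrow> c * real m powr b \<le> \<Phi> (T m)"
  shows False
proof -
  \<comment> \<open>\<open>m\<close> is so large that \<open>m powr b\<close> exceeds
    \<open>\<bar>\<Phi> 1 / c\<bar>\<close>; the added 1 ensures \<open>1 \<le> m\<close>.\<close>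
  obtain m :: nat where m: "\<bar>\<Phi> 1 / c\<bar> powr (1 / b) + 1 < real m" using reals_Archimedean2 by blast
  then have "1 \<le> m" by (smt (verit) One_nat_def Suc_leI of_nat_0 of_nat_0_less_iff powr_ge_zero)
  have "\<Phi> (T m) \<le> \<Phi> 1" using anti T[OF \<open>1 \<le> m\<close>] by (auto simp: monotone_on_def)
  then have "c * real m powr b \<le> \<Phi> 1" using lower[OF \<open>1 \<le> m\<close>] by linarith
  then have "real m powr b \<le> \<bar>\<Phi> 1 / c\<bar>" using assms(3) by (simp add: field_simps abs_if)
  moreover have "(\<bar>\<Phi> 1 / c\<bar> powr (1 / b)) powr b < real m powr b"
    using m assms(2) by (intro powr_less_mono2) auto
  ultimately show False using assms(2) by (simp add: powr_powr)
qed

text \<open>This turns the hypothesis on \<open>\<Phi>\<close>, applied to one power of the radius,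
  into real inequalities. Dividing by \<open>enn2real C + 1\<close> is safe even if
  \<open>C = 0\<close>.\<close>

lemma sample_from_norm_bound:
  fixes w :: "real ^ 'n \<Rightarrow> real"
  assumes w: "w = (\<lambda>x. radius K x powr s)"
    and bound: "\<forall>w \<in> Apq p q. sparse_op_norm \<alpha> S p q w \<le> C * ennreal (\<Phi> (enn2real (Apq_char p q w)))"
    and "C < \<infinity>" "0 \<le> X" "0 \<le> Y"
    and upper: "Apq_char p q w \<le> ennreal X" and lower: "ennreal Y \<le> sparse_op_norm \<alpha> S p q w"
    and pos: "\<forall>t\<ge>1. 0 < \<Phi> t"
  shows "1 \<le> enn2real (Apq_char p q w)" "enn2real (Apq_char p q w) \<le> X"
    and "Y / (enn2real C + 1) \<le> \<Phi> (enn2real (Apq_char p q w))"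
proof -
  have fin: "Apq_char p q w < \<infinity>" using upper by (auto intro: le_less_trans)
  have "1 \<le> Apq_char p q w" unfolding w by (rule Apq_char_radius_ge_1)
  then show T: "1 \<le> enn2real (Apq_char p q w)"
    using enn2real_mono[of 1 "Apq_char p q w"] fin by simp
  show "enn2real (Apq_char p q w) \<le> X" using upper assms(4) by (rule enn2real_leI[rotated])
  have "w \<in> Apq p q" using fin weight_radius_powr[of K s, where 'n = 'n]
    by (simp add: Apq_def w less_imp_neq[OF radius_pos, symmetric])
  then have "ennreal Y \<le> C * ennreal (\<Phi> (enn2real (Apq_char p q w)))"
    using bound lower order_trans by blast
  also have "\<dots> = ennreal (enn2real C * \<Phi> (enn2real (Apq_char p q w)))"
    using assms(3) pos T by (simp add: ennreal_mult less_imp_le)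
  finally have "Y \<le> enn2real C * \<Phi> (enn2real (Apq_char p q w))"
    using pos T by (simp add: less_imp_le)
  also have "\<dots> \<le> (enn2real C + 1) * \<Phi> (enn2real (Apq_char p q w))"
    using pos T by (intro mult_right_mono) (auto simp: less_imp_le)
  finally show "Y / (enn2real C + 1) \<le> \<Phi> (enn2real (Apq_char p q w))"
    by (simp add: field_simps add_pos_nonneg add_nonneg_pos)
qed

theorem proposition5p3:
  fixes \<alpha> p q :: real and \<Phi> :: "real \<Rightarrow> real"
  assumes "0 < \<alpha>" "\<alpha> < 1"
    and "1 < p" "p \<le> q"
    and "1 / q + 1 / dual_exp p = \<alpha>"
    and "\<forall>t\<ge>1. 0 < \<Phi> t"
    and "mono_on {1..} \<Phi> \<or> antimono_on {1..} \<Phi>"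
    and "\<forall>(D :: (real ^ 'n) set set) S. dyadic_grid D \<and> S \<subseteq> D \<and> sparse_collection S \<longrightarrow>
           (\<exists>C::ennreal. C < \<infinity> \<and>
              (\<forall>w \<in> Apq p q. sparse_op_norm \<alpha> S p q w \<le> C * ennreal (\<Phi> (enn2real (Apq_char p q w)))))"
  shows "\<exists>c>0. \<forall>t\<ge>1. \<Phi> t \<ge> c * t powr (max (dual_exp p / q * \<alpha>) (\<alpha> - 1 / 2))"
proof -
  have d: "0 < dual_exp p" and q: "0 < q" using assms by (auto simp: dual_exp_def)
  have "range dcube \<subseteq> (standard_grid :: (real ^ 'n) set set)" using dcube_in_standard_grid by blast
  then obtain C :: ennreal where C: "C < \<infinity>"
    "\<forall>w \<in> Apq p q. sparse_op_norm \<alpha> (range dcube :: (real ^ 'n) set set) p q w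
        \<le> C * ennreal (\<Phi> (enn2real (Apq_char p q w)))"
    using assms(8) dyadic_grid_standard sparse_collection_dcube by blast
  define R where "R = enn2real C + 1"
  have R: "0 < R" by (simp add: R_def add_nonneg_pos)
  \<comment> \<open>The factor 6 is the 3 of the average estimate doubled by the truncation level
    \<open>2 * m\<close>.\<close>
  define B :: real where "B = 6 * 16 ^ CARD('n)"
  have B: "0 < B" by (simp add: B_def)

  \<comment> \<open>First family: norm growth \<open>m powr \<alpha>\<close> against a
    characteristic of order at most \<open>m powr (q / dual_exp p)\<close>, hence the exponent
    \<open>dual_exp p / q * \<alpha>\<close>.\<close>
  define w1 where "w1 m = (\<lambda>x::real ^ 'n. radius (2 * m) x powr (real CARD('n) / dual_exp p))" for m :: nat
  define T1 where "T1 m = enn2real (Apq_char p q (w1 m))" for m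
  define c1 where "c1 = B powr (- 1 / p) / 2 * (1 / (2 * 2 powr (real CARD('n) * q / dual_exp p))) powr (1 / q)"
  have c1: "0 < c1" using B by (simp add: c1_def)
  have s1: "1 \<le> T1 m" "T1 m \<le> (B * real m) powr (q / dual_exp p)" "c1 * real m powr \<alpha> / R \<le> \<Phi> (T1 m)"
    if m: "1 \<le> m" for m
  proof -
    have "Apq_char p q (w1 m) \<le> ennreal ((3 * 16 ^ CARD('n) * real (2 * m)) powr (q / dual_exp p))"
      unfolding w1_def by (rule Apq_char_vanishing_weight_le) (use assms(3) q m in auto)
    also have "3 * 16 ^ CARD('n) * real (2 * m) = B * real m" by (simp add: B_def)
    finally have u: "Apq_char p q (w1 m) \<le> ennreal ((B * real m) powr (q / dual_exp p))" .
    have l: "ennreal (c1 * real m powr \<alpha>) \<le> sparse_op_norm \<alpha> (range dcube) p q (w1 m)"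
      unfolding w1_def c1_def B_def by (rule sparse_op_norm_ge_vanishing_weight[OF assms(3,4,5) m])
    have "0 \<le> c1 * real m powr \<alpha>" using c1 by simp
    note sample_from_norm_bound[OF w1_def C(2,1) powr_ge_zero this u l assms(6)]
    then show "1 \<le> T1 m" "T1 m \<le> (B * real m) powr (q / dual_exp p)" "c1 * real m powr \<alpha> / R \<le> \<Phi> (T1 m)"
      by (simp_all only: T1_def R_def)
  qed

  \<comment> \<open>Second family: norm growth \<open>m powr (\<alpha> - 1 / 2)\<close> against a
    characteristic at most linear in \<open>m\<close>.\<close>
  define w2 where "w2 m = (\<lambda>x::real ^ 'n. radius (2 * m) x powr (- (real CARD('n) / q)))" for m :: nat
  define T2 where "T2 m = enn2real (Apq_char p q (w2 m))" for m
  define c2 where "c2 = B powr (- 1 / p) * (1 / 2) powr (1 / q)"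
  have c2: "0 < c2" using B by (simp add: c2_def)
  have s2: "1 \<le> T2 m" "T2 m \<le> B * real m" "c2 * real m powr (\<alpha> - 1 / 2) / R \<le> \<Phi> (T2 m)"
    if m: "1 \<le> m" for m
  proof -
    have "Apq_char p q (w2 m) \<le> ennreal (3 * 16 ^ CARD('n) * real (2 * m))"
      unfolding w2_def by (rule Apq_char_singular_weight_le) (use assms(3) q m in auto)
    also have "3 * 16 ^ CARD('n) * real (2 * m) = B * real m" by (simp add: B_def)
    finally have u: "Apq_char p q (w2 m) \<le> ennreal (B * real m)" .
    have l: "ennreal (c2 * real m powr (\<alpha> - 1 / 2)) \<le> sparse_op_norm \<alpha> (range dcube) p q (w2 m)"
      unfolding w2_def c2_def B_def by (rule sparse_op_norm_ge_singular_weight[OF assms(3,4,5,2) m])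
    have "0 \<le> B * real m" "0 \<le> c2 * real m powr (\<alpha> - 1 / 2)" using B c2 by simp_all
    note sample_from_norm_bound[OF w2_def C(2,1) this u l assms(6)]
    then show "1 \<le> T2 m" "T2 m \<le> B * real m" "c2 * real m powr (\<alpha> - 1 / 2) / R \<le> \<Phi> (T2 m)"
      by (simp_all only: T2_def R_def)
  qed

  \<comment> \<open>The first family is the right one here: its exponent \<open>\<alpha>\<close> is
    positive, whereas \<open>\<alpha> - 1 / 2\<close> may fail to be.\<close>
  have mono: "mono_on {1..} \<Phi>"
    using assms(7) not_antimono_from_samples[of \<Phi> \<alpha> "c1 / R" T1] assms(1) c1 R s1 by auto
  show ?thesis
  proof (cases "\<alpha> - 1 / 2 \<le> dual_exp p / q * \<alpha>")
    case True
    have "\<exists>c>0. \<forall>t\<ge>1. c * t powr (dual_exp p / q * \<alpha>) \<le> \<Phi> t"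
    proof (rule power_growth_from_mono_samples[OF assms(6) mono, where a = "q / dual_exp p" and C = "B powr (q / dual_exp p)"
          and c = "c1 / R" and T = T1])
      show "T1 m \<le> B powr (q / dual_exp p) * real m powr (q / dual_exp p)" if "1 \<le> m" for m
        using s1(2)[OF that] by (simp add: powr_mult)
      show "c1 / R * real m powr (q / dual_exp p * (dual_exp p / q * \<alpha>)) \<le> \<Phi> (T1 m)" if "1 \<le> m" for m
        using s1(3)[OF that] d q by simp
    qed (use d q assms(1) c1 R B s1 in auto)
    then show ?thesis using True by (simp add: max_def)
  next
    case False
    \<comment> \<open>In this case \<open>\<alpha> - 1 / 2\<close> exceeds a nonnegative number,
      which gives the positive exponent that the growth lemma requires.\<close>
    have "0 \<le> dual_exp p / q * \<alpha>" using d q assms(1) by simp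
    with False have pos: "0 < \<alpha> - 1 / 2" by linarith
    have "\<exists>c>0. \<forall>t\<ge>1. c * t powr (\<alpha> - 1 / 2) \<le> \<Phi> t"
      by (rule power_growth_from_mono_samples[OF assms(6) mono, where a = 1 and C = B and c = "c2 / R" and T = T2])
        (use pos c2 R B s2 in auto)
    then show ?thesis using False by (simp add: max_def)
  qed
qed

end
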